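(* (Reid roundabout theorem.) Let $a<b$ with $[a,b]\subset\mathcal I$, and let $p>0$ and $q$ be continuous functions on $[a,b]$. Then the following are equivalent: (i) There is a solution $x$ of the self-adjoint equation $Lx=0$ on $[a,b]$ with $x\neq0$ on $[a,b]$. (ii) There is a solution $z$ of the Riccati equation $Rz=0$ on $[a,b]$. (iii) The quadratic functional $\mathcal F$ is positive definite on $\mathbb A$. (iv) The self-adjoint equation $Lx=0$ is disconjugate on $[a,b]$. (v) The solution $u$ of $Lx=0$ satisfying the initial conditions $u(a)=0$ and $D^{\alpha}u(a)=1/p(a)$ is nonzero on $(a,b]$. (vi) The solution $v$ of $Lx=0$ satisfying the initial conditions $v(b)=0$ and $D^{\alpha}v(b)=1/p(b)$ is nonzero on $[a,b)$.
   Context: $\mathcal I\subseteq\mathbb R$ is a nondegenerate interval. The functions $\kappa_0,\kappa_1:[0,1]\times\mathcal I\to[0,\infty)$ are continuous and satisfy, for all $t\in\mathcal I$: $\lim_{\alpha\to0^+}\kappa_1(\alpha,t)=1$, $\lim_{\alpha\to0^+}\kappa_0(\alpha,t)=0$, $\lim_{\alpha\to1^-}\kappa_1(\alpha,t)=0$, $\lim_{\alpha\to1^-}\kappa_0(\alpha,t)=1$, $\kappa_1(\alpha,t)\ne0$ for $\alpha\in[0,1)$, and $\kappa_0(\alpha,t)\neq0$ for $\alpha\in(0,1]$. Fix $\alpha\in(0,1]$ and write $\kappa_j(t)=\kappa_j(\alpha,t)$. The conformable (proportional) derivative is $D^{\alpha}f(t)=\kappa_1(t)f(t)+\kappa_0(t)f'(t)$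 (one-sided at endpoints). Write $d_\alpha t=dt/\kappa_0(t)$, and $e_0(t,s)=\exp\left(-\int_s^t\frac{\kappa_1(\tau)}{\kappa_0(\tau)}\,d\tau\right)$; $e_0^2(t,s)=(e_0(t,s))^2$. Set $Lx=D^{\alpha}[pD^{\alpha}x]+qx$. A solution of $Lx=0$ on $[a,b]$ is a continuous function $x$ on $[a,b]$ such that $D^{\alpha}x$ and $D^{\alpha}[pD^{\alpha}x]$ exist and are continuous and $Lx=0$ on $[a,b]$; solutions of initial value problems for $Lx=0$ exist uniquely on $[a,b]$. The equation $Lx=0$ is disconjugate on $[a,b]$ if no nontrivial solution has two (or more) zeros in $[a,b]$. The Riccati operator is $Rz=D^{\alpha}z+q+\frac{z^2}{p}-\kappa_1z$; a solution of $Rz=0$ on $[a,b]$ is a differentiable function $z$ with $D^{\alpha}z$ continuous and $Rz=0$ on $[a,b]$. The set of admissible functions is $\mathbb A=\{\eta\in C^1([a,b],\mathbb R)\setminus\{0\}:\eta(a)=\eta(b)=0\}$, where here $C^1([a,b],\mathbb R)$ denotes the continuous functions on $[a,b]$ whose ordinary derivative is piecewise continuous. The quadratic functional is $\mathcal F(\eta)=\int_a^b\left[p(D^{\alpha}\eta)^2-q\eta^2\right](t)\,e_0^2(b,t)\,d_\alpha t$. $\mathcal F$ is positive definite on $\mathbb A$ if $\mathcal F(\eta)\ge0$ for all $\eta\in\mathbb A$ and $\mathcal F(\eta)=0$ iff $\eta=0$ (so, as $0\notin\mathbb A$, $\mathcal F(\eta)>0$ for all $\eta\in\mathbb A$). 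*)

theory Defs
  imports "HOL-Analysis.Analysis"
begin

definition proportional_kernels ::
    "real set \<Rightarrow> (real \<Rightarrow> real \<Rightarrow> real) \<Rightarrow> (real \<Rightarrow> real \<Rightarrow> real) \<Rightarrow> bool" where
  "proportional_kernels I \<kappa>0 \<kappa>1 \<longleftrightarrow>
     continuous_on ({0..1} \<times> I) (\<lambda>(\<alpha>, t). \<kappa>0 \<alpha> t) \<and>
     continuous_on ({0..1} \<times> I) (\<lambda>(\<alpha>, t). \<kappa>1 \<alpha> t) \<and>
     (\<forall>\<alpha>\<in>{0..1}. \<forall>t\<in>I. 0 \<le> \<kappa>0 \<alpha> t \<and> 0 \<le> \<kappa>1 \<alpha> t) \<and>
     (\<forall>t\<in>I.
        ((\<lambda>\<alpha>. \<kappa>1 \<alpha> t) \<longlongrightarrow> 1) (at_right 0) \<and>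
        ((\<lambda>\<alpha>. \<kappa>0 \<alpha> t) \<longlongrightarrow> 0) (at_right 0) \<and>
        ((\<lambda>\<alpha>. \<kappa>1 \<alpha> t) \<longlongrightarrow> 0) (at_left 1) \<and>
        ((\<lambda>\<alpha>. \<kappa>0 \<alpha> t) \<longlongrightarrow> 1) (at_left 1) \<and>
        (\<forall>\<alpha>\<in>{0..<1}. \<kappa>1 \<alpha> t \<noteq> 0) \<and>
        (\<forall>\<alpha>\<in>{0<..1}. \<kappa>0 \<alpha> t \<noteq> 0))"

text \<open>From here on \<open>k0\<close> and \<open>k1\<close> stand for the slices \<open>\<kappa>0 \<alpha>\<close> and \<open>\<kappa>1 \<alpha>\<close> at a fixed
  \<open>\<alpha>\<close>. Functions on \<open>[a,b]\<close> are total functions on the reals; all derivatives are taken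
  within \<open>{a..b}\<close>, hence are one-sided at the endpoints, and nothing below depends on
  values outside \<open>{a..b}\<close>. The value of \<open>prop_deriv\<close> is meaningful only where the
  function is differentiable within \<open>{a..b}\<close>.\<close>

definition prop_deriv ::
    "(real \<Rightarrow> real) \<Rightarrow> (real \<Rightarrow> real) \<Rightarrow> real \<Rightarrow> real \<Rightarrow> (real \<Rightarrow> real) \<Rightarrow> real \<Rightarrow> real" where
  "prop_deriv k0 k1 a b f t =
     k1 t * f t + k0 t * vector_derivative f (at t within {a..b})"

text \<open>The interval integral is oriented, so \<open>t < s\<close> is allowed.\<close>

definition prop_exp0 :: "(real \<Rightarrow> real) \<Rightarrow> (real \<Rightarrow> real) \<Rightarrow> real \<Rightarrow> real \<Rightarrow> real" where
  "prop_exp0 k0 k1 t s = exp (- (LBINT \<tau>=ereal s..ereal t. k1 \<tau> / k0 \<tau>))"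

definition sl_op ::
    "(real \<Rightarrow> real) \<Rightarrow> (real \<Rightarrow> real) \<Rightarrow> (real \<Rightarrow> real) \<Rightarrow> (real \<Rightarrow> real) \<Rightarrow> real \<Rightarrow> real
      \<Rightarrow> (real \<Rightarrow> real) \<Rightarrow> real \<Rightarrow> real" where
  "sl_op k0 k1 p q a b x t =
     prop_deriv k0 k1 a b (\<lambda>s. p s * prop_deriv k0 k1 a b x s) t + q t * x t"

definition sl_solution ::
    "(real \<Rightarrow> real) \<Rightarrow> (real \<Rightarrow> real) \<Rightarrow> (real \<Rightarrow> real) \<Rightarrow> (real \<Rightarrow> real) \<Rightarrow> real \<Rightarrow> real
      \<Rightarrow> (real \<Rightarrow> real) \<Rightarrow> bool" where
  "sl_solution k0 k1 p q a b x \<longleftrightarrow>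
     continuous_on {a..b} x \<and>
     x differentiable_on {a..b} \<and>
     continuous_on {a..b} (prop_deriv k0 k1 a b x) \<and>
     (\<lambda>t. p t * prop_deriv k0 k1 a b x t) differentiable_on {a..b} \<and>
     continuous_on {a..b} (prop_deriv k0 k1 a b (\<lambda>t. p t * prop_deriv k0 k1 a b x t)) \<and>
     (\<forall>t\<in>{a..b}. sl_op k0 k1 p q a b x t = 0)"

definition sl_ivp_solution ::
    "(real \<Rightarrow> real) \<Rightarrow> (real \<Rightarrow> real) \<Rightarrow> (real \<Rightarrow> real) \<Rightarrow> (real \<Rightarrow> real) \<Rightarrow> real \<Rightarrow> real
      \<Rightarrow> real \<Rightarrow> real \<Rightarrow> real \<Rightarrow> (real \<Rightarrow> real) \<Rightarrow> bool" where
  "sl_ivp_solution k0 k1 p q a b t0 x0 x1 x \<longleftrightarrow>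
     sl_solution k0 k1 p q a b x \<and> x t0 = x0 \<and> prop_deriv k0 k1 a b x t0 = x1"

definition disconjugate ::
    "(real \<Rightarrow> real) \<Rightarrow> (real \<Rightarrow> real) \<Rightarrow> (real \<Rightarrow> real) \<Rightarrow> (real \<Rightarrow> real) \<Rightarrow> real \<Rightarrow> real \<Rightarrow> bool" where
  "disconjugate k0 k1 p q a b \<longleftrightarrow>
     (\<forall>x. sl_solution k0 k1 p q a b x \<and> (\<exists>t\<in>{a..b}. x t \<noteq> 0) \<longrightarrow>
        \<not> (\<exists>s\<in>{a..b}. \<exists>t\<in>{a..b}. s \<noteq> t \<and> x s = 0 \<and> x t = 0))"

definition riccati_op ::
    "(real \<Rightarrow> real) \<Rightarrow> (real \<Rightarrow> real) \<Rightarrow> (real \<Rightarrow> real) \<Rightarrow> (real \<Rightarrow> real) \<Rightarrow> real \<Rightarrow> real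
      \<Rightarrow> (real \<Rightarrow> real) \<Rightarrow> real \<Rightarrow> real" where
  "riccati_op k0 k1 p q a b z t =
     prop_deriv k0 k1 a b z t + q t + (z t)\<^sup>2 / p t - k1 t * z t"

definition riccati_solution ::
    "(real \<Rightarrow> real) \<Rightarrow> (real \<Rightarrow> real) \<Rightarrow> (real \<Rightarrow> real) \<Rightarrow> (real \<Rightarrow> real) \<Rightarrow> real \<Rightarrow> real
      \<Rightarrow> (real \<Rightarrow> real) \<Rightarrow> bool" where
  "riccati_solution k0 k1 p q a b z \<longleftrightarrow>
     z differentiable_on {a..b} \<and>
     continuous_on {a..b} (prop_deriv k0 k1 a b z) \<and>
     (\<forall>t\<in>{a..b}. riccati_op k0 k1 p q a b z t = 0)"

text \<open>Piecewise continuity of the derivative is meant in the usual sense: finitely many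
  exceptional points, and finite one-sided limits at every point. The library's
  \<open>piecewise_C1_differentiable_on\<close> imposes no one-sided limits, so it would admit functions
  for which the quadratic functional below diverges.\<close>

definition piecewise_C1 :: "real \<Rightarrow> real \<Rightarrow> (real \<Rightarrow> real) \<Rightarrow> bool" where
  "piecewise_C1 a b f \<longleftrightarrow>
     continuous_on {a..b} f \<and>
     (\<exists>T. finite T \<and>
        (\<forall>t\<in>{a..b} - T. f differentiable (at t within {a..b})) \<and>
        continuous_on ({a..b} - T) (\<lambda>t. vector_derivative f (at t within {a..b}))) \<and>
     (\<forall>t\<in>{a..<b}. \<exists>l. ((\<lambda>s. vector_derivative f (at s within {a..b})) \<longlongrightarrow> l) (at_right t)) \<and>
     (\<forall>t\<in>{a<..b}. \<exists>l. ((\<lambda>s. vector_derivative f (at s within {a..b})) \<longlongrightarrow> l) (at_left t))"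

definition admissible :: "real \<Rightarrow> real \<Rightarrow> (real \<Rightarrow> real) set" where
  "admissible a b =
     {\<eta>. piecewise_C1 a b \<eta> \<and> (\<exists>t\<in>{a..b}. \<eta> t \<noteq> 0) \<and> \<eta> a = 0 \<and> \<eta> b = 0}"

text \<open>The trailing \<open>/ k0 t\<close> is the weight of \<open>d\<^sub>\<alpha>t = dt / \<kappa>\<^sub>0(t)\<close>. The derivative of an
  admissible function may fail to exist at finitely many points, which do not affect the
  integral.\<close>

definition quad_functional ::
    "(real \<Rightarrow> real) \<Rightarrow> (real \<Rightarrow> real) \<Rightarrow> (real \<Rightarrow> real) \<Rightarrow> (real \<Rightarrow> real) \<Rightarrow> real \<Rightarrow> real
      \<Rightarrow> (real \<Rightarrow> real) \<Rightarrow> real" where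
  "quad_functional k0 k1 p q a b \<eta> =
     (LBINT t=ereal a..ereal b.
        (p t * (prop_deriv k0 k1 a b \<eta> t)\<^sup>2 - q t * (\<eta> t)\<^sup>2) * (prop_exp0 k0 k1 b t)\<^sup>2 / k0 t)"

definition positive_definite_on_admissible ::
    "(real \<Rightarrow> real) \<Rightarrow> (real \<Rightarrow> real) \<Rightarrow> (real \<Rightarrow> real) \<Rightarrow> (real \<Rightarrow> real) \<Rightarrow> real \<Rightarrow> real \<Rightarrow> bool" where
  "positive_definite_on_admissible k0 k1 p q a b \<longleftrightarrow>
     (\<forall>\<eta>\<in>admissible a b. 0 \<le> quad_functional k0 k1 p q a b \<eta>) \<and>
     (\<forall>\<eta>\<in>admissible a b. quad_functional k0 k1 p q a b \<eta> = 0 \<longleftrightarrow> (\<forall>t\<in>{a..b}. \<eta> t = 0))"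

definition all_equivalent :: "bool list \<Rightarrow> bool" where
  "all_equivalent Ps \<longleftrightarrow> (\<forall>P\<in>set Ps. \<forall>Q\<in>set Ps. P \<longleftrightarrow> Q)"

end

theory Submission imports Defs begin

text \<open>Let \<open>E(t) = exp (\<integral>\<^sub>a\<^sup>t \<kappa>\<^sub>1/\<kappa>\<^sub>0)\<close>. Since \<open>D\<^sup>\<alpha>f = \<kappa>\<^sub>0 (E f)' / E\<close>, the substitution \<open>X = E x\<close>,
  \<open>Y = E p D\<^sup>\<alpha>x\<close> turns \<open>Lx = 0\<close> into \<open>X' = Y/P\<close>, \<open>Y' = -Q X\<close> with \<open>P = p \<kappa>\<^sub>0\<close> and \<open>Q = q/\<kappa>\<^sub>0\<close>.
  A nonvanishing \<open>X\<close> yields the Riccati solution \<open>z = Y/X\<close> and conversely; Picone's identity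
  with \<open>z\<close> gives positivity of the functional; a solution with two zeros, cut off outside them, is an
  admissible function on which the functional vanishes. Finally, from a principal
  solution at one endpoint, a solution vanishing at the other endpoint with suitable
  slope can be added to obtain one without zeros, because the quotient of the two is
  monotone by constancy of the Wronskian.\<close>

section \<open>Linear systems of differential equations\<close>

text \<open>Increments of the Picard iteration for \<open>z' = A z\<close>, \<open>z a = z0\<close>:
  the partial sums of these terms are the iterates, so their series is the candidate
  solution.\<close>

primrec picard_term ::
    "(real \<Rightarrow> 'a::banach \<Rightarrow>\<^sub>L 'a) \<Rightarrow> 'a \<Rightarrow> real \<Rightarrow> nat \<Rightarrow> real \<Rightarrow> 'a" where
  "picard_term A z0 a 0 = (\<lambda>t. z0)"
| "picard_term A z0 a (Suc n) = (\<lambda>t. integral {a..t} (\<lambda>s. blinfun_apply (A s) (picard_term A z0 a n s)))"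

lemma picard_term_continuous:
  assumes "continuous_on {a..b} A"
  shows "continuous_on {a..b} (picard_term A z0 a n)"
proof (induction n)
  case 0
  then show ?case by simp
next
  case (Suc n)
  have "continuous_on {a..b} (\<lambda>s. blinfun_apply (A s) (picard_term A z0 a n s))"
    by (intro continuous_intros assms Suc)
  then show ?case
    using indefinite_integral_continuous_1[OF integrable_continuous_real] by simp
qed

lemma picard_term_vector_derivative:
  assumes "continuous_on {a..b} A" "t \<in> {a..b}"
  shows "(picard_term A z0 a (Suc n) has_vector_derivative A t (picard_term A z0 a n t))
    (at t within {a..b})"
proof -
  have "continuous_on {a..b} (\<lambda>s. blinfun_apply (A s) (picard_term A z0 a n s))"
    by (intro continuous_intros assms picard_term_continuous)
  from integral_has_vector_derivative[OF this assms(2)] show ?thesis by simp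
qed

text \<open>Integrating the bound for the previous term raises the power of \<open>t - a\<close> by
  one and divides by \<open>Suc n\<close>; the factorial gained this way makes the series converge
  uniformly on \<open>{a..b}\<close>.\<close>

lemma picard_term_bound:
  assumes A: "continuous_on {a..b} A" and M: "\<And>s. s \<in> {a..b} \<Longrightarrow> norm (A s) \<le> M"
    and t: "t \<in> {a..b}"
  shows "norm (picard_term A z0 a n t) \<le> norm z0 * (M * (t - a)) ^ n / fact n"
  using t
proof (induction n arbitrary: t)
  case 0
  then show ?case by simp
next
  case (Suc n)
  define g where "g = (\<lambda>s. norm z0 * M ^ Suc n * (s - a) ^ n / fact n)"
  have sub: "{a..t} \<subseteq> {a..b}" using Suc.prems by auto
  have "M \<ge> 0" using M[OF Suc.prems] norm_ge_zero order_trans by blast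
  have "((\<lambda>s. norm z0 * (M * (s - a)) ^ Suc n / fact (Suc n)) has_vector_derivative g s)
      (at s within {a..t})" for s
    unfolding has_real_derivative_iff_has_vector_derivative[symmetric] g_def power_mult_distrib
    by (rule derivative_eq_intros refl | simp add: field_simps del: power_Suc of_nat_Suc)+
  from fundamental_theorem_of_calculus[OF _ this] Suc.prems
  have g: "(g has_integral norm z0 * (M * (t - a)) ^ Suc n / fact (Suc n)) {a..t}"
    by simp
  have "norm (picard_term A z0 a (Suc n) t) \<le> integral {a..t} g"
    unfolding picard_term.simps
  proof (rule integral_norm_bound_integral)
    show "(\<lambda>s. blinfun_apply (A s) (picard_term A z0 a n s)) integrable_on {a..t}"
      by (intro integrable_continuous_real continuous_intros continuous_on_subset[OF _ sub]
          A picard_term_continuous)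
    show "g integrable_on {a..t}" using g by blast
    fix s assume "s \<in> {a..t}"
    then have s: "s \<in> {a..b}" using sub by blast
    have "norm (A s (picard_term A z0 a n s)) \<le> M * (norm z0 * (M * (s - a)) ^ n / fact n)"
      by (rule order_trans[OF norm_blinfun mult_mono[OF M[OF s] Suc.IH[OF s]]]) (simp_all add: \<open>M \<ge> 0\<close>)
    also have "\<dots> = g s" by (simp add: g_def power_mult_distrib mult_ac)
    finally show "norm (A s (picard_term A z0 a n s)) \<le> g s" .
  qed
  also have "\<dots> = norm z0 * (M * (t - a)) ^ Suc n / fact (Suc n)"
    using g by (rule integral_unique)
  finally show ?case .
qed

text \<open>The Picard series may be differentiated term by term: its partial sums converge
  uniformly by the Weierstrass test, and the differentiated ones are \<open>A t\<close> applied to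
  earlier partial sums, hence converge uniformly too.\<close>

lemma linear_ode_exists:
  fixes A :: "real \<Rightarrow> 'a::banach \<Rightarrow>\<^sub>L 'a"
  assumes A: "continuous_on {a..b} A" and "a \<le> b"
  obtains z where "z a = z0"
    "\<And>t. t \<in> {a..b} \<Longrightarrow> (z has_vector_derivative A t (z t)) (at t within {a..b})"
proof -
  define T where "T = picard_term A z0 a"
  define z where "z = (\<lambda>t. \<Sum>n. T n t)"
  have "compact (A ` {a..b})" using A by (intro compact_continuous_image) auto
  from compact_imp_bounded[OF this] obtain M
    where "M > 0" and M: "\<And>s. s \<in> {a..b} \<Longrightarrow> norm (A s) \<le> M"
    unfolding bounded_pos by auto
  have T_bound: "norm (T n t) \<le> norm z0 * (M * (b - a)) ^ n / fact n" if t: "t \<in> {a..b}" for n t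
  proof -
    have "norm (T n t) \<le> norm z0 * (M * (t - a)) ^ n / fact n"
      unfolding T_def by (rule picard_term_bound[OF A M t])
    also have "\<dots> \<le> norm z0 * (M * (b - a)) ^ n / fact n"
      using t \<open>M > 0\<close> by (intro divide_right_mono mult_left_mono power_mono) auto
    finally show ?thesis .
  qed
  have summ: "summable (\<lambda>n. norm z0 * (M * (b - a)) ^ n / fact n)"
    using summable_mult[OF summable_exp[of "M * (b - a)"], of "norm z0"]
    by (simp add: field_simps)
  have unif: "uniform_limit {a..b} (\<lambda>n t. \<Sum>i<n. T i t) z sequentially"
    unfolding z_def by (rule Weierstrass_m_test[OF T_bound summ])
  have sums: "(\<lambda>n. T n t) sums z t" if "t \<in> {a..b}" for t
    unfolding sums_def by (rule tendsto_uniform_limitI[OF unif that])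
  define T' where "T' = (\<lambda>n t (h::real). h *\<^sub>R (case n of 0 \<Rightarrow> 0 | Suc m \<Rightarrow> A t (T m t)))"
  have T': "(T n has_derivative T' n t) (at t within {a..b})" if "t \<in> {a..b}" for n t
    using picard_term_vector_derivative[OF A that]
    by (cases n) (auto simp: T'_def T_def has_vector_derivative_def)
  have T'_sum: "(\<Sum>i<Suc n. T' i t h) = h *\<^sub>R A t (\<Sum>i<n. T i t)" for n t h
    unfolding sum.lessThan_Suc_shift
    by (simp add: T'_def blinfun.sum_right scaleR_sum_right)
  have conv: "\<forall>\<^sub>F n in sequentially. \<forall>t\<in>{a..b}. \<forall>h.
      norm (sum (\<lambda>i. T' i t h) {..<n} - h *\<^sub>R A t (z t)) \<le> e * norm h" if "e > 0" for e
  proof -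
    have "\<forall>\<^sub>F n in sequentially. \<forall>t\<in>{a..b}. dist (\<Sum>i<n. T i t) (z t) < e / M"
      using unif \<open>e > 0\<close> \<open>M > 0\<close> unfolding uniform_limit_iff by simp
    then have "\<forall>\<^sub>F n in sequentially. \<forall>t\<in>{a..b}. \<forall>h.
      norm (sum (\<lambda>i. T' i t h) {..<Suc n} - h *\<^sub>R A t (z t)) \<le> e * norm h"
    proof (rule eventually_mono, intro ballI allI)
      fix n t and h :: real
      assume "\<forall>t\<in>{a..b}. dist (\<Sum>i<n. T i t) (z t) < e / M" and t: "t \<in> {a..b}"
      then have d: "norm ((\<Sum>i<n. T i t) - z t) \<le> e / M" by (auto simp: dist_norm intro: less_imp_le)
      have "norm (A t ((\<Sum>i<n. T i t) - z t)) \<le> M * (e / M)"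
        by (rule order_trans[OF norm_blinfun mult_mono[OF M[OF t] d]]) (use \<open>M > 0\<close> in auto)
      then have "norm (A t ((\<Sum>i<n. T i t) - z t)) \<le> e" using \<open>M > 0\<close> by simp
      then have "\<bar>h\<bar> * norm (A t ((\<Sum>i<n. T i t) - z t)) \<le> \<bar>h\<bar> * e"
        by (rule mult_left_mono) simp
      then show "norm (sum (\<lambda>i. T' i t h) {..<Suc n} - h *\<^sub>R A t (z t)) \<le> e * norm h"
        unfolding T'_sum scaleR_diff_right[symmetric] blinfun.diff_right[symmetric]
        by (simp add: mult.commute)
    qed
    then show ?thesis by (subst (asm) eventually_sequentially_Suc)
  qed
  have "a \<in> {a..b}" using \<open>a \<le> b\<close> by simp
  from has_derivative_series[OF convex_real_interval(5) T' conv this sums[OF this]]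
  obtain g where g: "\<And>t. t \<in> {a..b} \<Longrightarrow> (\<lambda>n. T n t) sums g t"
    "\<And>t. t \<in> {a..b} \<Longrightarrow> (g has_derivative (\<lambda>h. h *\<^sub>R A t (z t))) (at t within {a..b})"
    by blast
  have gz: "g t = z t" if "t \<in> {a..b}" for t
    using sums_unique2[OF g(1) sums] that by blast
  show ?thesis
  proof
    have "T n a = (if n = 0 then z0 else 0)" for n
      by (cases n) (auto simp: T_def)
    then show "g a = z0"
      using sums_unique2[OF g(1)[OF \<open>a \<in> {a..b}\<close>]] sums_single[of 0 "\<lambda>_. z0"] by simp
    show "(g has_vector_derivative A t (g t)) (at t within {a..b})" if "t \<in> {a..b}" for t
      using g(2)[OF that] gz[OF that] by (simp add: has_vector_derivative_def)
  qed
qed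

text \<open>The pair \<open>(X, Y)\<close> solves one linear equation in
  \<open>real \<times> real\<close>. Its operator combines two constant operators with the scalar
  factors \<open>f\<close> and \<open>g\<close>, so it inherits their continuity.\<close>

lemma linear_system_exists:
  fixes f g :: "real \<Rightarrow> real"
  assumes "continuous_on {a..b} f" "continuous_on {a..b} g" "a \<le> b"
  obtains X Y where "X a = x0" "Y a = y0"
    "\<And>t. t \<in> {a..b} \<Longrightarrow> (X has_real_derivative f t * Y t) (at t within {a..b})"
    "\<And>t. t \<in> {a..b} \<Longrightarrow> (Y has_real_derivative g t * X t) (at t within {a..b})"
proof -
  define B where "B = Blinfun (\<lambda>w::real \<times> real. (snd w, 0::real))"
  define C where "C = Blinfun (\<lambda>w::real \<times> real. (0::real, fst w))"
  have B: "blinfun_apply B w = (snd w, 0)" and C: "blinfun_apply C w = (0, fst w)" for w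
    unfolding B_def C_def
    by (subst bounded_linear_Blinfun_apply; auto intro!: bounded_linear_intros)+
  define A where "A = (\<lambda>t. f t *\<^sub>R B + g t *\<^sub>R C)"
  have A: "blinfun_apply (A t) w = (f t * snd w, g t * fst w)" for t w
    by (simp add: A_def plus_blinfun.rep_eq scaleR_blinfun.rep_eq B C)
  have "continuous_on {a..b} A" unfolding A_def by (intro continuous_intros assms)
  from linear_ode_exists[OF this \<open>a \<le> b\<close>, of "(x0, y0)"] obtain z
    where z: "z a = (x0, y0)"
      "\<And>t. t \<in> {a..b} \<Longrightarrow> (z has_vector_derivative A t (z t)) (at t within {a..b})"
    by blast
  show ?thesis
  proof
    show "(fst \<circ> z) a = x0" "(snd \<circ> z) a = y0" using z(1) by auto
    fix t assume "t \<in> {a..b}"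
    note z' = z(2)[OF this, unfolded A]
    show "((fst \<circ> z) has_real_derivative f t * (snd \<circ> z) t) (at t within {a..b})"
      using bounded_linear.has_vector_derivative[OF bounded_linear_fst z']
      by (simp add: has_real_derivative_iff_has_vector_derivative o_def)
    show "((snd \<circ> z) has_real_derivative g t * (fst \<circ> z) t) (at t within {a..b})"
      using bounded_linear.has_vector_derivative[OF bounded_linear_snd z']
      by (simp add: has_real_derivative_iff_has_vector_derivative o_def)
  qed
qed

text \<open>The reflection of \<open>t\<close> to \<open>a + b - t\<close> exchanges the endpoints
  and flips the sign of derivatives, so data at \<open>b\<close> become data at \<open>a\<close> for
  the system with negated coefficients.\<close>

lemma linear_system_exists_right:
  fixes f g :: "real \<Rightarrow> real"
  assumes "continuous_on {a..b} f" "continuous_on {a..b} g" "a \<le> b"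
  obtains X Y where "X b = x0" "Y b = y0"
    "\<And>t. t \<in> {a..b} \<Longrightarrow> (X has_real_derivative f t * Y t) (at t within {a..b})"
    "\<And>t. t \<in> {a..b} \<Longrightarrow> (Y has_real_derivative g t * X t) (at t within {a..b})"
proof -
  define r where "r = (\<lambda>t::real. a + b - t)"
  have r: "r ` {a..b} = {a..b}" unfolding r_def image_diff_atLeastAtMost by simp
  have cont: "continuous_on {a..b} r" unfolding r_def by (intro continuous_intros)
  have "continuous_on {a..b} (\<lambda>t. - f (r t))" "continuous_on {a..b} (\<lambda>t. - g (r t))"
    by (intro continuous_intros continuous_on_compose2[OF assms(1) cont]
        continuous_on_compose2[OF assms(2) cont]; simp add: r)+
  \<comment> \<open>The interval is written as its image under \<open>r\<close>, the form in which
    \<open>DERIV_image_chain\<close> expects the outer derivative.\<close>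
  from linear_system_exists[OF this \<open>a \<le> b\<close>, of x0 y0] obtain X Y where XY: "X a = x0" "Y a = y0"
    "\<And>t. t \<in> {a..b} \<Longrightarrow> (X has_real_derivative - f (r t) * Y t) (at t within r ` {a..b})"
    "\<And>t. t \<in> {a..b} \<Longrightarrow> (Y has_real_derivative - g (r t) * X t) (at t within r ` {a..b})"
    unfolding r by metis
  show ?thesis
  proof
    show "(X \<circ> r) b = x0" "(Y \<circ> r) b = y0" using XY by (auto simp: r_def)
    fix t assume t: "t \<in> {a..b}"
    then have rt: "r t \<in> {a..b}" "r (r t) = t" by (auto simp: r_def)
    have r': "(r has_real_derivative -1) (at t within {a..b})"
      unfolding r_def by (auto intro!: derivative_eq_intros)
    show "((X \<circ> r) has_real_derivative f t * (Y \<circ> r) t) (at t within {a..b})"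
      using DERIV_image_chain[OF XY(3)[OF rt(1)] r'] rt by simp
    show "((Y \<circ> r) has_real_derivative g t * (X \<circ> r) t) (at t within {a..b})"
      using DERIV_image_chain[OF XY(4)[OF rt(1)] r'] rt by simp
  qed
qed

text \<open>A Gronwall argument for the energy \<open>N = X^2 + Y^2\<close>: its derivative is at
  most \<open>K N\<close> in absolute value. Weighted with exponent \<open>- K\<close> to the right
  of \<open>t0\<close> and \<open>K\<close> to the left, the energy does not increase when moving
  away from \<open>t0\<close>, where it is zero.\<close>

lemma linear_system_unique_zero:
  fixes f g X Y :: "real \<Rightarrow> real"
  assumes f: "continuous_on {a..b} f" and g: "continuous_on {a..b} g"
    and X: "\<And>t. t \<in> {a..b} \<Longrightarrow> (X has_real_derivative f t * Y t) (at t within {a..b})"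
    and Y: "\<And>t. t \<in> {a..b} \<Longrightarrow> (Y has_real_derivative g t * X t) (at t within {a..b})"
    and t0: "t0 \<in> {a..b}" "X t0 = 0" "Y t0 = 0"
    and t: "t \<in> {a..b}"
  shows "X t = 0"
proof -
  have "compact ((\<lambda>t. f t + g t) ` {a..b})"
    using f g by (intro compact_continuous_image continuous_intros) auto
  from compact_imp_bounded[OF this] obtain K
    where K: "\<forall>s\<in>{a..b}. \<bar>f s + g s\<bar> \<le> K"
    unfolding bounded_iff by auto
  define N where "N = (\<lambda>t. (X t)\<^sup>2 + (Y t)\<^sup>2)"
  have N': "((\<lambda>s. exp (c * s) * N s) has_real_derivative
      exp (c * s) * (c * N s + 2 * (f s + g s) * (X s * Y s))) (at s within {a..b})"
    if "s \<in> {a..b}" for c s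
    unfolding N_def using that
    by (auto intro!: derivative_eq_intros X Y simp: algebra_simps power2_eq_square)
  have bound: "\<bar>2 * (f s + g s) * (X s * Y s)\<bar> \<le> K * N s" if "s \<in> {a..b}" for s
  proof -
    have "2 * \<bar>X s * Y s\<bar> \<le> N s"
      using sum_squares_bound[of "\<bar>X s\<bar>" "\<bar>Y s\<bar>"] by (simp add: N_def abs_mult)
    then have "\<bar>f s + g s\<bar> * (2 * \<bar>X s * Y s\<bar>) \<le> K * N s"
      using K that by (intro mult_mono) auto
    then show ?thesis by (simp only: abs_mult abs_numeral mult_ac)
  qed
  have N0: "N t0 = 0" using t0 by (simp add: N_def)
  have cont: "continuous_on {a..b} (\<lambda>s. exp (c * s) * N s)" for c
    by (rule DERIV_continuous_on[OF N'])
  have "exp (c * t) * N t \<le> 0" if c: "c = (if t0 \<le> t then - K else K)" for c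
  proof (cases "t0 \<le> t")
    case True
    have "exp (c * t) * N t \<le> exp (c * t0) * N t0"
    proof (rule DERIV_nonpos_imp_decreasing_open[OF True, of "\<lambda>s. exp (c * s) * N s"])
      fix s assume s: "t0 < s" "s < t"
      then have s': "s \<in> {a..b}" "at s within {a..b} = at s"
        using t t0 by (auto intro!: at_within_Icc_at)
      have "c * N s + 2 * (f s + g s) * (X s * Y s) \<le> 0"
        using bound[OF s'(1)] c True by (simp only: if_True mult_minus_left abs_le_iff) linarith
      from mult_nonneg_nonpos[OF _ this, of "exp (c * s)"] N'[OF s'(1), of c]
      show "\<exists>y. ((\<lambda>s. exp (c * s) * N s) has_real_derivative y) (at s) \<and> y \<le> 0"
        unfolding s'(2) by (blast intro: exp_ge_zero)
    qed (rule continuous_on_subset[OF cont], use t t0 in auto)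
    then show ?thesis by (simp add: N0)
  next
    case False
    have "exp (c * t) * N t \<le> exp (c * t0) * N t0"
    proof (rule DERIV_nonneg_imp_increasing_open[of t t0 "\<lambda>s. exp (c * s) * N s"])
      show "t \<le> t0" using False by simp
      fix s assume s: "t < s" "s < t0"
      then have s': "s \<in> {a..b}" "at s within {a..b} = at s"
        using t t0 by (auto intro!: at_within_Icc_at)
      have "0 \<le> c * N s + 2 * (f s + g s) * (X s * Y s)"
        using bound[OF s'(1)] c False by (simp only: if_False abs_le_iff) linarith
      from mult_nonneg_nonneg[OF _ this, of "exp (c * s)"] N'[OF s'(1), of c]
      show "\<exists>y. ((\<lambda>s. exp (c * s) * N s) has_real_derivative y) (at s) \<and> 0 \<le> y"
        unfolding s'(2) by (blast intro: exp_ge_zero)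
    qed (rule continuous_on_subset[OF cont], use t t0 in auto)
    then show ?thesis by (simp add: N0)
  qed
  from this[OF refl] have "N t \<le> 0" by (simp add: mult_le_0_iff)
  then show ?thesis by (simp add: N_def sum_power2_le_zero_iff)
qed

section \<open>Integration of piecewise continuous functions\<close>

text \<open>Bisection reduces the claim to small intervals around a point \<open>x\<close>. There
  the one-sided limits bound \<open>h\<close> on either side; the value \<open>h x\<close>, of which
  they say nothing, is added separately.\<close>

lemma bounded_if_one_sided_limits:
  fixes h :: "real \<Rightarrow> real"
  assumes "a \<le> b"
    and right: "\<And>t. t \<in> {a..<b} \<Longrightarrow> \<exists>l. (h \<longlongrightarrow> l) (at_right t)"
    and left: "\<And>t. t \<in> {a<..b} \<Longrightarrow> \<exists>l. (h \<longlongrightarrow> l) (at_left t)"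
  shows "bounded (h ` {a..b})"
proof -
  \<comment> \<open>The intervals of the bisection may stick out of \<open>{a..b}\<close>;
    intersecting with \<open>J\<close> discards the excess. A separate name keeps these endpoints
    fixed while the induction varies the others.\<close>
  define J where "J = {a..b}"
  have "\<exists>M. \<forall>t\<in>{a..b} \<inter> J. \<bar>h t\<bar> \<le> M"
    using \<open>a \<le> b\<close>
  proof (induction rule: Bolzano)
    case (trans c d e)
    then obtain M M' where "\<forall>t\<in>{c..d} \<inter> J. \<bar>h t\<bar> \<le> M" "\<forall>t\<in>{d..e} \<inter> J. \<bar>h t\<bar> \<le> M'"
      by blast
    then have "\<bar>h t\<bar> \<le> max M M'" if "t \<in> {c..e} \<inter> J" for t
      using that by (cases "t \<le> d") (auto simp: le_max_iff_disj)
    then show ?case by (intro exI[of _ "max M M'"] ballI)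
  next
    case (local x)
    have ev: "\<exists>M. \<forall>\<^sub>F t in F. \<bar>h t\<bar> \<le> M" if "(h \<longlongrightarrow> l) F" for F l
    proof -
      have "\<forall>\<^sub>F t in F. \<bar>h t\<bar> < \<bar>l\<bar> + 1"
        using order_tendstoD(2)[OF tendsto_rabs[OF that], of "\<bar>l\<bar> + 1"] by simp
      then show ?thesis by (intro exI[of _ "\<bar>l\<bar> + 1"]) (auto elim: eventually_mono)
    qed
    obtain M1 r where r: "r > x" "\<And>t. x < t \<Longrightarrow> t < r \<Longrightarrow> t \<le> b \<Longrightarrow> \<bar>h t\<bar> \<le> M1"
    proof (cases "x < b")
      case True
      with right[of x] local obtain l where "(h \<longlongrightarrow> l) (at_right x)" by auto
      from ev[OF this] obtain M c where "c > x" "\<forall>t>x. t < c \<longrightarrow> \<bar>h t\<bar> \<le> M"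
        unfolding eventually_at_right_field by blast
      then show ?thesis by (intro that[of c M]) auto
    next
      case False
      show ?thesis by (rule that[of "x + 1" 0]) (use False in auto)
    qed
    obtain M2 l where l: "l < x" "\<And>t. l < t \<Longrightarrow> t < x \<Longrightarrow> a \<le> t \<Longrightarrow> \<bar>h t\<bar> \<le> M2"
    proof (cases "a < x")
      case True
      with left[of x] local obtain l where "(h \<longlongrightarrow> l) (at_left x)" by auto
      from ev[OF this] obtain M c where "c < x" "\<forall>t>c. t < x \<longrightarrow> \<bar>h t\<bar> \<le> M"
        unfolding eventually_at_left_field by blast
      then show ?thesis by (intro that[of c M]) auto
    next
      case False
      show ?thesis by (rule that[of "x - 1" 0]) (use False in auto)
    qed
    define M where "M = max \<bar>h x\<bar> (max M1 M2)"
    have "\<bar>h t\<bar> \<le> M" if "t \<in> {a..b}" "l < t" "t < r" for t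
      using r(2)[of t] l(2)[of t] that unfolding M_def by (cases t x rule: linorder_cases) auto
    then have "\<forall>t\<in>{c..d} \<inter> J. \<bar>h t\<bar> \<le> M"
      if "c \<le> x \<and> x \<le> d \<and> d - c < min (r - x) (x - l)" for c d
      using that unfolding J_def by auto
    moreover have "0 < min (r - x) (x - l)" using r l by simp
    ultimately show ?case
      by (intro exI[of _ "min (r - x) (x - l)"]) (simp only: simp_thms, blast)
  qed
  then show ?thesis by (auto simp: bounded_iff J_def)
qed

text \<open>Setting \<open>G\<close> to zero on the finite set \<open>T\<close> does not affect
  integrability; the changed function is measurable, being continuous on a Borel set and zero
  outside, and bounded on a set of finite measure.\<close>

lemma set_integrable_bounded_continuous_off_finite:
  fixes G :: "real \<Rightarrow> real"
  assumes "finite T" and cont: "continuous_on ({a..b} - T) G" and "bounded (G ` {a..b})"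
  shows "set_integrable lborel {a..b} G"
proof -
  from assms(3) obtain B where B: "\<forall>t\<in>{a..b}. \<bar>G t\<bar> \<le> B" by (auto simp: bounded_iff)
  have T: "{a..b} - T \<in> sets borel"
    using \<open>finite T\<close> by (intro sets.Diff) (auto intro: borel_closed finite_imp_closed)
  define g where "g = (\<lambda>x. indicator ({a..b} - T) x *\<^sub>R G x)"
  have "integrable lborel (\<lambda>x. indicator {a..b} x *\<^sub>R g x)"
  proof (rule integrableI_bounded_set_indicator)
    show "g \<in> borel_measurable lborel"
      unfolding g_def using borel_measurable_continuous_on_indicator[OF T cont] by simp
    show "AE x in lborel. x \<in> {a..b} \<longrightarrow> norm (g x) \<le> \<bar>B\<bar>"
      using B by (intro AE_I2) (force simp: g_def indicator_def)
  qed (auto simp: emeasure_lborel_Icc_eq)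
  moreover have "integrable lborel (\<lambda>x. indicator {a..b} x *\<^sub>R G x) \<longleftrightarrow>
      integrable lborel (\<lambda>x. indicator {a..b} x *\<^sub>R g x)"
    by (rule integrable_discrete_difference[where X = T])
      (use \<open>finite T\<close> in \<open>auto simp: g_def indicator_def countable_finite\<close>)
  ultimately show ?thesis unfolding set_integrable_def by simp
qed

text \<open>Boundedness of \<open>h\<close> confines its graph to a compact rectangle, on which
  \<Phi> is bounded. The intended \<open>h\<close> is the derivative of a piecewise smooth
  function.\<close>

lemma set_integrable_compose_bounded:
  fixes \<Phi> :: "real \<times> real \<Rightarrow> real"
  assumes \<Phi>: "continuous_on ({a..b} \<times> UNIV) \<Phi>" and "finite T"
    and h: "continuous_on ({a..b} - T) h" and bdd: "bounded (h ` {a..b})"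
  shows "set_integrable lborel {a..b} (\<lambda>t. \<Phi> (t, h t))"
proof (rule set_integrable_bounded_continuous_off_finite[OF \<open>finite T\<close>])
  show "continuous_on ({a..b} - T) (\<lambda>t. \<Phi> (t, h t))"
    by (rule continuous_on_compose2[OF \<Phi>]) (auto intro!: continuous_intros h)
  from bdd obtain M where M: "\<forall>t\<in>{a..b}. \<bar>h t\<bar> \<le> M" by (auto simp: bounded_iff)
  have "compact (\<Phi> ` ({a..b} \<times> {-M..M}))"
    by (intro compact_continuous_image continuous_on_subset[OF \<Phi>] compact_Times) auto
  then have "bounded (\<Phi> ` ({a..b} \<times> {-M..M}))" by (rule compact_imp_bounded)
  then show "bounded ((\<lambda>t. \<Phi> (t, h t)) ` {a..b})"
    by (rule bounded_subset) (use M in \<open>force simp: abs_le_iff\<close>)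
qed

text \<open>A small closed interval around \<open>t\<close> avoids \<open>T\<close>. The integral of
  \<open>r\<close> over it lies between zero and the vanishing total, and a nonnegative continuous
  function with integral zero is zero.\<close>

lemma nonneg_has_integral_zero:
  fixes r :: "real \<Rightarrow> real"
  assumes "finite T" and cont: "continuous_on ({a..b} - T) r"
    and nonneg: "\<And>s. s \<in> {a..b} \<Longrightarrow> 0 \<le> r s" and int: "(r has_integral 0) {a..b}"
    and t: "t \<in> {a<..<b} - T"
  shows "r t = 0"
proof -
  have "open ({a<..<b} - T)" using \<open>finite T\<close> by (intro open_Diff finite_imp_closed) auto
  from open_contains_cball[THEN iffD1, OF this] t obtain e
    where "e > 0" and e: "cball t e \<subseteq> {a<..<b} - T" by blast
  then have sub: "{t-e..t+e} \<subseteq> {a<..<b} - T" by (simp add: cball_eq_atLeastAtMost)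
  moreover have "{a<..<b} - T \<subseteq> {a..b} - T" by auto
  ultimately have sub': "{t-e..t+e} \<subseteq> {a..b}" "{t-e..t+e} \<subseteq> {a..b} - T" by blast+
  have r: "r integrable_on {a..b}" using int by blast
  then have r': "r integrable_on {t-e..t+e}" using sub'(1) by (rule integrable_on_subinterval)
  have "integral {t-e..t+e} r \<le> integral {a..b} r"
    using integral_subset_le[OF sub'(1) r' r] nonneg by blast
  then have "integral {t-e..t+e} r \<le> 0" using int by (simp add: integral_unique)
  moreover have "0 \<le> integral {t-e..t+e} r"
    using r' by (rule integral_nonneg) (use nonneg sub' in blast)
  ultimately have "(r has_integral 0) (cbox (t-e) (t+e))"
    using r' by (metis integrable_integral antisym box_real(2))
  then show ?thesis
    by (rule has_integral_0_cbox_imp_0[rotated 2])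
      (use \<open>e > 0\<close> nonneg sub' continuous_on_subset[OF cont sub'(2)] in auto)
qed

section \<open>The proportional Sturm--Liouville equation\<close>

locale proportional_sl =
  fixes k0 k1 p q :: "real \<Rightarrow> real" and a b :: real
  assumes a_less_b: "a < b"
    and k0_continuous: "continuous_on {a..b} k0" and k1_continuous: "continuous_on {a..b} k1"
    and p_continuous: "continuous_on {a..b} p" and q_continuous: "continuous_on {a..b} q"
    and k0_pos: "t \<in> {a..b} \<Longrightarrow> 0 < k0 t" and p_pos: "t \<in> {a..b} \<Longrightarrow> 0 < p t"
begin

section \<open>The integrating factor of the proportional derivative\<close>

abbreviation D :: "(real \<Rightarrow> real) \<Rightarrow> real \<Rightarrow> real" where
  "D \<equiv> prop_deriv k0 k1 a b"

text \<open>On \<open>{a..b}\<close> this is the reciprocal of \<open>prop_exp0 k0 k1 t a\<close>;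
  multiplication by it absorbs the zeroth-order term of \<open>D\<close>.\<close>

definition E :: "real \<Rightarrow> real" where
  "E t = exp (integral {a..t} (\<lambda>s. k1 s / k0 s))"

lemma E_nonzero [simp]: "E t \<noteq> 0"
  by (simp add: E_def)

lemma ratio_continuous: "continuous_on {a..b} (\<lambda>s. k1 s / k0 s)"
  by (intro continuous_intros k0_continuous k1_continuous) (use k0_pos in force)

lemma E_derivative:
  assumes "t \<in> {a..b}"
  shows "(E has_real_derivative E t * (k1 t / k0 t)) (at t within {a..b})"
  unfolding E_def [abs_def]
  by (rule DERIV_chain2[OF DERIV_exp integral_has_real_derivative[OF ratio_continuous assms]])

lemma E_continuous: "continuous_on {a..b} E"
  by (rule DERIV_continuous_on[OF E_derivative])

text \<open>The integrals over \<open>{a..t}\<close> and \<open>{t..b}\<close> add up to a constant,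
  so the weight of the functional becomes a quotient of integrating factors.\<close>

lemma prop_exp0_eq:
  assumes "t \<in> {a..b}"
  shows "prop_exp0 k0 k1 b t = E t / E b"
proof -
  have "(LBINT \<tau>=ereal t..ereal b. k1 \<tau> / k0 \<tau>) = integral {t..b} (\<lambda>s. k1 s / k0 s)"
    by (rule interval_integral_eq_integral)
      (use assms in \<open>auto intro!: borel_integrable_atLeastAtMost' continuous_on_subset[OF ratio_continuous]\<close>)
  moreover have "integral {a..t} (\<lambda>s. k1 s / k0 s) + integral {t..b} (\<lambda>s. k1 s / k0 s)
      = integral {a..b} (\<lambda>s. k1 s / k0 s)"
    using assms
    by (intro Henstock_Kurzweil_Integration.integral_combine integrable_continuous_real ratio_continuous) auto
  ultimately show ?thesis
    by (simp add: prop_exp0_def E_def exp_diff[symmetric])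
qed

lemma prop_deriv_eq:
  assumes "t \<in> {a..b}" "(f has_real_derivative d) (at t within {a..b})"
  shows "D f t = k1 t * f t + k0 t * d"
  using vector_derivative_within_closed_interval[OF a_less_b assms(1), of f d] assms(2)
  by (simp add: prop_deriv_def has_real_derivative_iff_has_vector_derivative)

lemma prop_deriv_has_derivative:
  assumes "t \<in> {a..b}" "f differentiable (at t within {a..b})"
  shows "(f has_real_derivative (D f t - k1 t * f t) / k0 t) (at t within {a..b})"
proof -
  from assms(2) obtain d where d: "(f has_real_derivative d) (at t within {a..b})"
    by (auto simp: real_differentiable_def)
  moreover have "d = (D f t - k1 t * f t) / k0 t"
    using prop_deriv_eq[OF assms(1) d] k0_pos[OF assms(1)] by (simp add: field_simps)
  ultimately show ?thesis by simp
qed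

text \<open>In the product rule the derivative of \<open>E\<close> accounts exactly for the
  \<open>k1\<close> part of \<open>D f\<close>.\<close>

lemma scaled_derivative:
  assumes "t \<in> {a..b}" "f differentiable (at t within {a..b})"
  shows "((\<lambda>s. E s * f s) has_real_derivative E t * D f t / k0 t) (at t within {a..b})"
  using DERIV_mult[OF E_derivative[OF assms(1)] prop_deriv_has_derivative[OF assms]] k0_pos[OF assms(1)]
  by (simp add: field_simps)

text \<open>The reverse passage, by the quotient rule. Agreement of \<open>f\<close> with
  \<open>N / E\<close> is asked for on the interval only, so that the rule covers
  \<open>p D x\<close>, whose formula is known only there.\<close>

lemma unscaled_derivative:
  assumes "t \<in> {a..b}" "(N has_real_derivative d) (at t within {a..b})"
    and "\<And>s. s \<in> {a..b} \<Longrightarrow> f s = N s / E s"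
  shows "f differentiable (at t within {a..b})" "D f t = k0 t * d / E t"
proof -
  have "((\<lambda>s. N s / E s) has_real_derivative d / E t - k1 t / k0 t * (N t / E t)) (at t within {a..b})"
    by (rule DERIV_cong[OF DERIV_divide[OF assms(2) E_derivative[OF assms(1)] E_nonzero]])
      (use k0_pos[OF assms(1)] in \<open>simp add: field_simps\<close>)
  then have f: "(f has_real_derivative d / E t - k1 t / k0 t * (N t / E t)) (at t within {a..b})"
    by (rule has_field_derivative_transform_within[OF _ zero_less_one assms(1)]) (use assms(3) in auto)
  then show "f differentiable (at t within {a..b})" by (auto simp: real_differentiable_def)
  show "D f t = k0 t * d / E t"
    using prop_deriv_eq[OF assms(1) f] k0_pos[OF assms(1)] assms(3)[OF assms(1)]
    by (simp add: field_simps)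
qed

section \<open>The equivalent first-order Hamiltonian system\<close>

definition hamiltonian :: "(real \<Rightarrow> real) \<Rightarrow> (real \<Rightarrow> real) \<Rightarrow> bool" where
  "hamiltonian X Y \<longleftrightarrow> (\<forall>t\<in>{a..b}.
     (X has_real_derivative (1 / (p t * k0 t)) * Y t) (at t within {a..b}) \<and>
     (Y has_real_derivative (- q t / k0 t) * X t) (at t within {a..b}))"

lemma hamiltonianD:
  assumes "hamiltonian X Y" "t \<in> {a..b}"
  shows "(X has_real_derivative (1 / (p t * k0 t)) * Y t) (at t within {a..b})"
    and "(Y has_real_derivative (- q t / k0 t) * X t) (at t within {a..b})"
  using assms unfolding hamiltonian_def by blast+

lemma hamiltonian_continuous:
  assumes "hamiltonian X Y"
  shows "continuous_on {a..b} X" "continuous_on {a..b} Y"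
  by (rule DERIV_continuous_on[OF hamiltonianD(1)[OF assms]] DERIV_continuous_on[OF hamiltonianD(2)[OF assms]];
      assumption)+

lemma coefficients_continuous:
  "continuous_on {a..b} (\<lambda>t. 1 / (p t * k0 t))" "continuous_on {a..b} (\<lambda>t. - q t / k0 t)"
  by (intro continuous_intros p_continuous q_continuous k0_continuous;
      use p_pos k0_pos in force)+

lemma sl_solution_imp_hamiltonian:
  assumes "sl_solution k0 k1 p q a b x"
  shows "hamiltonian (\<lambda>t. E t * x t) (\<lambda>t. E t * (p t * D x t))"
  unfolding hamiltonian_def
proof (intro ballI conjI)
  fix t assume t: "t \<in> {a..b}"
  have x: "x differentiable (at t within {a..b})" "(\<lambda>t. p t * D x t) differentiable (at t within {a..b})"
    "D (\<lambda>t. p t * D x t) t = - q t * x t"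
    using assms t unfolding sl_solution_def differentiable_on_def sl_op_def
    by (auto simp: eq_neg_iff_add_eq_0)
  show "((\<lambda>t. E t * x t) has_real_derivative 1 / (p t * k0 t) * (E t * (p t * D x t))) (at t within {a..b})"
    using scaled_derivative[OF t x(1)] p_pos[OF t] by (simp add: field_simps)
  show "((\<lambda>t. E t * (p t * D x t)) has_real_derivative - q t / k0 t * (E t * x t)) (at t within {a..b})"
    using scaled_derivative[OF t x(2)] by (simp add: x(3) field_simps)
qed

text \<open>\<open>Y / E\<close> is recovered as \<open>p D x\<close>, so the second equation of the
  system becomes \<open>Lx = 0\<close>; the second claim serves to read off initial slopes.\<close>

lemma hamiltonian_imp_sl_solution:
  assumes XY: "hamiltonian X Y"
  shows "sl_solution k0 k1 p q a b (\<lambda>t. X t / E t)"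
    and "\<And>t. t \<in> {a..b} \<Longrightarrow> p t * D (\<lambda>t. X t / E t) t = Y t / E t"
proof -
  define x where "x = (\<lambda>t. X t / E t)"
  have x: "x differentiable (at t within {a..b})" "D x t = Y t / (p t * E t)" if "t \<in> {a..b}" for t
    using unscaled_derivative[OF that hamiltonianD(1)[OF XY that], of x] p_pos[OF that] k0_pos[OF that]
    by (simp_all add: x_def field_simps)
  show pDx: "p t * D x t = Y t / E t" if "t \<in> {a..b}" for t
    using x(2)[OF that] p_pos[OF that] by simp
  have y: "(\<lambda>t. p t * D x t) differentiable (at t within {a..b})"
      "D (\<lambda>t. p t * D x t) t = - q t * x t" if "t \<in> {a..b}" for t
    using unscaled_derivative[OF that hamiltonianD(2)[OF XY that] pDx] k0_pos[OF that]
    by (simp_all add: x_def field_simps)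
  have cx: "continuous_on {a..b} x"
    unfolding x_def by (intro continuous_intros hamiltonian_continuous[OF XY] E_continuous) simp
  have "continuous_on {a..b} (\<lambda>t. Y t / (p t * E t))"
    by (intro continuous_intros hamiltonian_continuous[OF XY] E_continuous p_continuous)
      (use p_pos in force)
  then have "continuous_on {a..b} (D x)" by (rule continuous_on_eq) (simp add: x(2))
  moreover have "continuous_on {a..b} (\<lambda>t. - q t * x t)"
    by (intro continuous_intros q_continuous cx)
  then have "continuous_on {a..b} (D (\<lambda>t. p t * D x t))" by (rule continuous_on_eq) (simp add: y(2))
  ultimately have "sl_solution k0 k1 p q a b x"
    using cx x y unfolding sl_solution_def sl_op_def differentiable_on_def by simp
  then show "sl_solution k0 k1 p q a b (\<lambda>t. X t / E t)" unfolding x_def .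
qed

lemma hamiltonian_exists_left:
  obtains X Y where "hamiltonian X Y" "X a = x0" "Y a = y0"
proof (rule linear_system_exists[OF coefficients_continuous less_imp_le[OF a_less_b], of x0 y0])
  fix X Y assume "X a = x0" "Y a = y0"
    "\<And>t. t \<in> {a..b} \<Longrightarrow> (X has_real_derivative 1 / (p t * k0 t) * Y t) (at t within {a..b})"
    "\<And>t. t \<in> {a..b} \<Longrightarrow> (Y has_real_derivative - q t / k0 t * X t) (at t within {a..b})"
  then show ?thesis by (intro that[of X Y]) (simp_all add: hamiltonian_def)
qed

lemma hamiltonian_exists_right:
  obtains X Y where "hamiltonian X Y" "X b = x0" "Y b = y0"
proof (rule linear_system_exists_right[OF coefficients_continuous less_imp_le[OF a_less_b], of x0 y0])
  fix X Y assume "X b = x0" "Y b = y0"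
    "\<And>t. t \<in> {a..b} \<Longrightarrow> (X has_real_derivative 1 / (p t * k0 t) * Y t) (at t within {a..b})"
    "\<And>t. t \<in> {a..b} \<Longrightarrow> (Y has_real_derivative - q t / k0 t * X t) (at t within {a..b})"
  then show ?thesis by (intro that[of X Y]) (simp_all add: hamiltonian_def)
qed

text \<open>On a nondegenerate interval the derivative is unique, so vanishing of \<open>X\<close>
  turns the first equation into \<open>Y / (p k0) = 0\<close>.\<close>

lemma hamiltonian_vanish_interval:
  assumes XY: "hamiltonian X Y" and "s < t" "{s..t} \<subseteq> {a..b}"
    and X: "\<And>c. c \<in> {s..t} \<Longrightarrow> X c = 0" and c: "c \<in> {s..t}"
  shows "Y c = 0"
proof -
  have c': "c \<in> {a..b}" using c assms(3) by blast
  have "(X has_real_derivative 0) (at c within {s..t})"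
    by (rule has_field_derivative_transform_within[OF _ zero_less_one c, of "\<lambda>_. 0"]) (use X in auto)
  moreover have "(X has_real_derivative (1 / (p c * k0 c)) * Y c) (at c within {s..t})"
    using hamiltonianD(1)[OF XY c'] assms(3) by (rule DERIV_subset)
  ultimately have "(1 / (p c * k0 c)) * Y c = 0"
    using vector_derivative_within_closed_interval[OF \<open>s < t\<close> c]
    unfolding has_real_derivative_iff_has_vector_derivative by metis
  then show ?thesis using p_pos[OF c'] k0_pos[OF c'] by simp
qed

lemma hamiltonian_vanish:
  assumes "hamiltonian X Y" "t0 \<in> {a..b}" "X t0 = 0" "Y t0 = 0" "t \<in> {a..b}"
  shows "X t = 0"
  by (rule linear_system_unique_zero[OF coefficients_continuous, of X Y t0])
    (use assms hamiltonianD in auto)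

section \<open>Wronskians and zero-free combinations of solutions\<close>

lemma wronskian_constant:
  assumes UY: "hamiltonian U Y" and VZ: "hamiltonian V Z" and t: "t \<in> {a..b}"
  shows "Y t * V t - U t * Z t = Y a * V a - U a * Z a"
proof -
  \<comment> \<open>Both pairs solve the same system, so the two products with \<open>q\<close>
    cancel, as do the two with \<open>1 / (p k0)\<close>.\<close>
  have "((\<lambda>t. Y t * V t - U t * Z t) has_real_derivative 0) (at s within {a..b})"
    if s: "s \<in> {a..b}" for s
    using p_pos[OF s] k0_pos[OF s]
    by (auto intro!: derivative_eq_intros hamiltonianD[OF UY s] hamiltonianD[OF VZ s] simp: field_simps)
  then have "\<exists>c. \<forall>s\<in>{a..b}. Y s * V s - U s * Z s = c"
    by (intro has_field_derivative_zero_constant) auto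
  then show ?thesis using t a_less_b by auto
qed

text \<open>The numerator of the quotient rule is the Wronskian divided by \<open>p k0\<close>; as
  the Wronskian is constant, the quotient is monotone between zeros of \<open>V\<close>.\<close>

lemma quotient_derivative:
  assumes UY: "hamiltonian U Y" and VZ: "hamiltonian V Z" and t: "a < t" "t < b" "V t \<noteq> 0"
  shows "((\<lambda>t. U t / V t) has_real_derivative
      (Y a * V a - U a * Z a) / (p t * k0 t * (V t)\<^sup>2)) (at t)"
proof -
  have t': "t \<in> {a..b}" "at t within {a..b} = at t" using t at_within_Icc_at by auto
  show ?thesis
    using DERIV_divide[OF hamiltonianD(1)[OF UY t'(1)] hamiltonianD(1)[OF VZ t'(1)] t(3)]
      p_pos[OF t'(1)] k0_pos[OF t'(1)] t(3)
    unfolding t'(2) wronskian_constant[OF UY VZ t'(1), symmetric]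
    by (simp add: field_simps power2_eq_square)
qed

text \<open>A solution \<open>V\<close> vanishing at \<open>b\<close> is added to \<open>U\<close>.
  As \<open>V / U\<close> decreases to zero at \<open>b\<close>, the two never have opposite signs
  on \<open>{a<..b}\<close>, so \<open>U + V\<close> has no zero there; at \<open>a\<close> its
  value is \<open>V a\<close>, nonzero by the Wronskian.\<close>

lemma nonvanishing_from_left:
  assumes UY: "hamiltonian U Y" "U a = 0" "Y a \<noteq> 0" and U: "\<And>t. t \<in> {a<..b} \<Longrightarrow> U t \<noteq> 0"
  obtains X X' where "hamiltonian X X'" "\<And>t. t \<in> {a..b} \<Longrightarrow> X t \<noteq> 0"
proof -
  \<comment> \<open>The slope \<open>- U b\<close> makes the Wronskian minus the square of
    \<open>U b\<close>, which fixes the direction of monotonicity.\<close>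
  obtain V Z where VZ: "hamiltonian V Z" "V b = 0" "Z b = - U b"
    by (rule hamiltonian_exists_right)
  have W: "Z a * U a - V a * Y a = - (U b)\<^sup>2"
    using wronskian_constant[OF VZ(1) UY(1), of b] a_less_b VZ by (simp add: power2_eq_square)
  have "U b \<noteq> 0" using U a_less_b by simp
  with W UY have "V a \<noteq> 0" by auto
  have quot: "0 \<le> V t / U t" if t: "t \<in> {a<..b}" for t
  proof -
    have "V b / U b \<le> V t / U t"
    proof (rule DERIV_nonpos_imp_decreasing_open[of t b "\<lambda>t. V t / U t"])
      show "continuous_on {t..b} (\<lambda>t. V t / U t)"
        using t U by (intro continuous_intros continuous_on_subset[OF hamiltonian_continuous(1)[OF VZ(1)]]
            continuous_on_subset[OF hamiltonian_continuous(1)[OF UY(1)]]) auto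
      fix s assume s: "t < s" "s < b"
      have "(- (U b)\<^sup>2) / (p s * k0 s * (U s)\<^sup>2) \<le> 0"
        using p_pos[of s] k0_pos[of s] s t by (intro divide_nonpos_nonneg) auto
      then show "\<exists>y. ((\<lambda>t. V t / U t) has_real_derivative y) (at s) \<and> y \<le> 0"
        using quotient_derivative[OF VZ(1) UY(1), of s] s t U[of s] unfolding W by auto
    qed (use t in auto)
    then show ?thesis by (simp add: VZ)
  qed
  show ?thesis
  proof (rule that[of "\<lambda>t. U t + V t" "\<lambda>t. Y t + Z t"])
    show "hamiltonian (\<lambda>t. U t + V t) (\<lambda>t. Y t + Z t)"
      unfolding hamiltonian_def distrib_left
      by (intro ballI conjI DERIV_add hamiltonianD[OF UY(1)] hamiltonianD[OF VZ(1)])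
    show "U t + V t \<noteq> 0" if "t \<in> {a..b}" for t
    proof (cases "t = a")
      case False
      then have "t \<in> {a<..b}" using that by auto
      with quot[OF this] U[OF this] show ?thesis
        by (auto simp: zero_le_divide_iff add_eq_0_iff)
    qed (use UY \<open>V a \<noteq> 0\<close> in auto)
  qed
qed

text \<open>The mirror image: the added solution \<open>U\<close> vanishes at \<open>a\<close> with
  slope datum \<open>V a\<close>, so the Wronskian is the square of \<open>V a\<close> and
  \<open>U / V\<close> increases from zero; at \<open>b\<close>, where \<open>V\<close> vanishes,
  the Wronskian gives \<open>U b \<noteq> 0\<close>.\<close>

lemma nonvanishing_from_right:
  assumes VZ: "hamiltonian V Z" "V b = 0" "Z b \<noteq> 0" and V: "\<And>t. t \<in> {a..<b} \<Longrightarrow> V t \<noteq> 0"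
  obtains X X' where "hamiltonian X X'" "\<And>t. t \<in> {a..b} \<Longrightarrow> X t \<noteq> 0"
proof -
  obtain U Y where UY: "hamiltonian U Y" "U a = 0" "Y a = V a"
    by (rule hamiltonian_exists_left)
  have W: "Y a * V a - U a * Z a = (V a)\<^sup>2"
    using UY by (simp add: power2_eq_square)
  have "V a \<noteq> 0" using V a_less_b by simp
  with W wronskian_constant[OF UY(1) VZ(1), of b] VZ(2) a_less_b have "U b \<noteq> 0" by auto
  have quot: "0 \<le> U t / V t" if t: "t \<in> {a..<b}" for t
  proof -
    have "U a / V a \<le> U t / V t"
    proof (rule DERIV_nonneg_imp_increasing_open[of a t "\<lambda>t. U t / V t"])
      show "continuous_on {a..t} (\<lambda>t. U t / V t)"
        using t V by (intro continuous_intros continuous_on_subset[OF hamiltonian_continuous(1)[OF VZ(1)]]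
            continuous_on_subset[OF hamiltonian_continuous(1)[OF UY(1)]]) auto
      fix s assume s: "a < s" "s < t"
      have "0 \<le> (V a)\<^sup>2 / (p s * k0 s * (V s)\<^sup>2)"
        using p_pos[of s] k0_pos[of s] s t by (intro divide_nonneg_nonneg) auto
      then show "\<exists>y. ((\<lambda>t. U t / V t) has_real_derivative y) (at s) \<and> 0 \<le> y"
        using quotient_derivative[OF UY(1) VZ(1), of s] s t V[of s] unfolding W by auto
    qed (use t in auto)
    then show ?thesis by (simp add: UY)
  qed
  show ?thesis
  proof (rule that[of "\<lambda>t. U t + V t" "\<lambda>t. Y t + Z t"])
    show "hamiltonian (\<lambda>t. U t + V t) (\<lambda>t. Y t + Z t)"
      unfolding hamiltonian_def distrib_left
      by (intro ballI conjI DERIV_add hamiltonianD[OF UY(1)] hamiltonianD[OF VZ(1)])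
    show "U t + V t \<noteq> 0" if "t \<in> {a..b}" for t
    proof (cases "t = b")
      case False
      then have "t \<in> {a..<b}" using that by auto
      with quot[OF this] V[OF this] show ?thesis
        by (auto simp: zero_le_divide_iff add_eq_0_iff)
    qed (use VZ \<open>U b \<noteq> 0\<close> in auto)
  qed
qed

section \<open>Passage between zero-free solutions and Riccati solutions\<close>

lemma riccati_derivative:
  assumes "riccati_solution k0 k1 p q a b z" and t: "t \<in> {a..b}"
  shows "(z has_real_derivative (- q t - (z t)\<^sup>2 / p t) / k0 t) (at t within {a..b})"
proof -
  have "z differentiable (at t within {a..b})" and "D z t + q t + (z t)\<^sup>2 / p t - k1 t * z t = 0"
    using assms unfolding riccati_solution_def riccati_op_def differentiable_on_def by auto
  \<comment> \<open>The term \<open>k1 z\<close> subtracted in the Riccati operator cancels the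
    zeroth-order part of \<open>D z\<close>, leaving an ordinary Riccati equation.\<close>
  moreover from this(2) have "D z t - k1 t * z t = - q t - (z t)\<^sup>2 / p t" by simp
  ultimately show ?thesis using prop_deriv_has_derivative[OF t] by metis
qed

lemma nonvanishing_imp_riccati:
  assumes XY: "hamiltonian X Y" and X: "\<And>t. t \<in> {a..b} \<Longrightarrow> X t \<noteq> 0"
  shows "riccati_solution k0 k1 p q a b (\<lambda>t. Y t / X t)"
proof -
  define z where "z = (\<lambda>t. Y t / X t)"
  have z': "(z has_real_derivative (- q t - (z t)\<^sup>2 / p t) / k0 t) (at t within {a..b})"
    if t: "t \<in> {a..b}" for t
    unfolding z_def
    by (rule DERIV_cong[OF DERIV_divide[OF hamiltonianD(2,1)[OF XY t] X[OF t]]])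
      (use X[OF t] p_pos[OF t] k0_pos[OF t] in \<open>simp add: field_simps power2_eq_square\<close>)
  have Dz: "D z t = k1 t * z t - q t - (z t)\<^sup>2 / p t" if "t \<in> {a..b}" for t
    using prop_deriv_eq[OF that z'[OF that]] k0_pos[OF that] by simp
  have "continuous_on {a..b} (\<lambda>t. k1 t * z t - q t - (z t)\<^sup>2 / p t)"
    by (intro continuous_intros k1_continuous q_continuous p_continuous DERIV_continuous_on[OF z'])
      (use p_pos in force)+
  then have "continuous_on {a..b} (D z)" by (rule continuous_on_eq) (simp add: Dz)
  moreover have "z differentiable_on {a..b}"
    unfolding differentiable_on_def using z' real_differentiable_def by blast
  ultimately show ?thesis
    unfolding riccati_solution_def riccati_op_def z_def[symmetric] by (simp add: Dz)
qed

text \<open>The substitution \<open>z = Y / X\<close> read backwards: the first equation becomes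
  \<open>X' = z X / (p k0)\<close>, solved by an exponential, and the Riccati equation then gives
  the second one for \<open>Y = z X\<close>.\<close>

lemma riccati_imp_nonvanishing:
  assumes z: "riccati_solution k0 k1 p q a b z"
  obtains X where "hamiltonian X (\<lambda>t. z t * X t)" "\<And>t. 0 < X t"
proof -
  define X where "X = (\<lambda>t. exp (integral {a..t} (\<lambda>s. z s / (p s * k0 s))))"
  have "continuous_on {a..b} (\<lambda>s. z s / (p s * k0 s))"
    by (intro continuous_intros p_continuous k0_continuous DERIV_continuous_on[OF riccati_derivative[OF z]])
      (use p_pos k0_pos in force)+
  then have X': "(X has_real_derivative X t * (z t / (p t * k0 t))) (at t within {a..b})"
    if "t \<in> {a..b}" for t
    unfolding X_def using that by (intro DERIV_chain2[OF DERIV_exp integral_has_real_derivative])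
  have "hamiltonian X (\<lambda>t. z t * X t)"
    unfolding hamiltonian_def
  proof (intro ballI conjI)
    fix t assume t: "t \<in> {a..b}"
    show "(X has_real_derivative 1 / (p t * k0 t) * (z t * X t)) (at t within {a..b})"
      by (rule DERIV_cong[OF X'[OF t]]) simp
    show "((\<lambda>t. z t * X t) has_real_derivative - q t / k0 t * X t) (at t within {a..b})"
      by (rule DERIV_cong[OF DERIV_mult[OF riccati_derivative[OF z t] X'[OF t]]])
        (use p_pos[OF t] k0_pos[OF t] in \<open>simp add: field_simps power2_eq_square\<close>)
  qed
  then show ?thesis by (rule that) (simp add: X_def)
qed

subsection \<open>The quadratic functional\<close>

definition integrand :: "(real \<Rightarrow> real) \<Rightarrow> real \<Rightarrow> real" where
  "integrand \<eta> t = (p t * (D \<eta> t)\<^sup>2 - q t * (\<eta> t)\<^sup>2) * (E t / E b)\<^sup>2 / k0 t"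

lemma piecewise_C1_obtain:
  assumes "piecewise_C1 a b \<eta>"
  obtains T where "finite T" "\<And>t. t \<in> {a..b} - T \<Longrightarrow> \<eta> differentiable (at t within {a..b})"
    "continuous_on ({a..b} - T) (\<lambda>t. vector_derivative \<eta> (at t within {a..b}))"
  using assms unfolding piecewise_C1_def by blast

text \<open>The functional is a Lebesgue interval integral; integrability lets it be treated as a
  gauge integral, to which the fundamental theorem with exceptional points applies.\<close>

lemma quad_functional_has_integral:
  assumes \<eta>: "piecewise_C1 a b \<eta>"
  shows "(integrand \<eta> has_integral quad_functional k0 k1 p q a b \<eta>) {a..b}"
proof -
  define h where "h = (\<lambda>t. vector_derivative \<eta> (at t within {a..b}))"
  obtain T where T: "finite T" "continuous_on ({a..b} - T) h"
    using piecewise_C1_obtain[OF \<eta>] unfolding h_def by metis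
  have bdd: "bounded (h ` {a..b})"
    using \<eta> a_less_b unfolding piecewise_C1_def h_def
    by (intro bounded_if_one_sided_limits) auto
  have c\<eta>: "continuous_on {a..b} \<eta>" using \<eta> by (simp add: piecewise_C1_def)
  \<comment> \<open>The derivative of \<eta> enters as a second variable, so the integrand is a
    continuous function composed with a piecewise continuous one.\<close>
  define \<Phi> where "\<Phi> = (\<lambda>w. (p (fst w) * (k1 (fst w) * \<eta> (fst w) + k0 (fst w) * snd w)\<^sup>2
      - q (fst w) * (\<eta> (fst w))\<^sup>2) * (E (fst w) / E b)\<^sup>2 / k0 (fst w))"
  have fst: "continuous_on ({a..b} \<times> UNIV) (\<lambda>w. f (fst w))"
    if "continuous_on {a..b} f" for f :: "real \<Rightarrow> real"
    by (rule continuous_on_compose2[OF that]) (auto intro: continuous_intros)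
  have "continuous_on ({a..b} \<times> UNIV) \<Phi>"
    unfolding \<Phi>_def
    by (intro continuous_intros fst p_continuous q_continuous k0_continuous k1_continuous E_continuous c\<eta>)
      (use k0_pos in force)+
  from set_integrable_compose_bounded[OF this T bdd]
  have int: "set_integrable lborel {a..b} (integrand \<eta>)"
    by (simp add: \<Phi>_def h_def integrand_def [abs_def] prop_deriv_def)
  define g where "g = (\<lambda>t. (p t * (D \<eta> t)\<^sup>2 - q t * (\<eta> t)\<^sup>2) * (prop_exp0 k0 k1 b t)\<^sup>2 / k0 t)"
  have g: "g t = integrand \<eta> t" if "t \<in> {a..b}" for t
    using that by (simp add: g_def integrand_def prop_exp0_eq)
  have "set_integrable lborel {a..b} g"
    using int by (rule set_integrable_cong[THEN iffD1, rotated -1]) (simp_all add: g)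
  then have "quad_functional k0 k1 p q a b \<eta> = integral {a..b} g"
    unfolding quad_functional_def g_def[symmetric]
    using a_less_b by (intro interval_integral_eq_integral) auto
  also have "\<dots> = integral {a..b} (integrand \<eta>)" by (rule integral_cong) (rule g)
  finally show ?thesis
    using set_borel_integral_eq_integral(1)[OF int] by (simp add: has_integral_integral)
qed

lemma has_integral_derivative_off_finite:
  assumes "finite T" "continuous_on {a..b} H"
    and "\<And>t. t \<in> {a..b} - T \<Longrightarrow> (H has_real_derivative d t) (at t within {a..b})"
  shows "(d has_integral (H b - H a)) {a..b}"
proof (rule fundamental_theorem_of_calculus_interior_strong[OF assms(1) less_imp_le[OF a_less_b] _ assms(2)])
  fix t assume t: "t \<in> {a<..<b} - T"
  then have "at t within {a..b} = at t" by (intro at_within_Icc_at) auto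
  with assms(3)[of t] t show "(H has_vector_derivative d t) (at t)"
    by (simp add: has_real_derivative_iff_has_vector_derivative)
qed

text \<open>Picone's identity: up to the factor \<open>(E/E(b))\<^sup>2/\<kappa>\<^sub>0\<close>, the integrand is an exact derivative
  plus the square \<open>p (D\<^sup>\<alpha>\<eta> - z \<eta>/p)\<^sup>2\<close>.\<close>

lemma riccati_imp_quad_functional_pos:
  assumes z: "riccati_solution k0 k1 p q a b z" and adm: "\<eta> \<in> admissible a b"
  shows "0 < quad_functional k0 k1 p q a b \<eta>"
proof -
  have \<eta>: "piecewise_C1 a b \<eta>" "\<eta> a = 0" "\<eta> b = 0" and nz: "\<exists>t\<in>{a..b}. \<eta> t \<noteq> 0"
    using adm by (auto simp: admissible_def)
  obtain T where T: "finite T" and diff: "\<And>t. t \<in> {a..b} - T \<Longrightarrow> \<eta> differentiable (at t within {a..b})"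
    and h: "continuous_on ({a..b} - T) (\<lambda>t. vector_derivative \<eta> (at t within {a..b}))"
    using piecewise_C1_obtain[OF \<eta>(1)] by metis
  have c\<eta>: "continuous_on {a..b} \<eta>" using \<eta>(1) by (simp add: piecewise_C1_def)
  have cz: "continuous_on {a..b} z" by (rule DERIV_continuous_on[OF riccati_derivative[OF z]])
  define w where "w = (\<lambda>t. (E t / E b)\<^sup>2 / k0 t)"
  \<comment> \<open>By the Riccati equation \<open>d\<close> is the derivative of \<open>H\<close>
    off \<open>T\<close>; \<open>H\<close> vanishes at both ends with \<eta>, and \<open>r\<close>
    is the remaining square.\<close>
  define d where "d = (\<lambda>t. w t * ((- q t - (z t)\<^sup>2 / p t) * (\<eta> t)\<^sup>2 + 2 * z t * \<eta> t * D \<eta> t))"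
  define r where "r = (\<lambda>t. w t * p t * (D \<eta> t - z t * \<eta> t / p t)\<^sup>2)"
  define H where "H = (\<lambda>t. z t * (E t * \<eta> t)\<^sup>2 / (E b)\<^sup>2)"
  have N': "((\<lambda>t. E t * \<eta> t) has_real_derivative E t * D \<eta> t / k0 t) (at t within {a..b})"
    if "t \<in> {a..b} - T" for t
    using scaled_derivative[OF _ diff[OF that]] that by blast
  have "(d has_integral (H b - H a)) {a..b}"
  proof (rule has_integral_derivative_off_finite[OF T])
    show "continuous_on {a..b} H"
      unfolding H_def by (intro continuous_intros cz E_continuous c\<eta>) simp
    show "(H has_real_derivative d t) (at t within {a..b})" if t: "t \<in> {a..b} - T" for t
    proof -
      have t': "t \<in> {a..b}" using t by blast
      show ?thesis
        unfolding H_def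
        by (rule DERIV_cong[OF DERIV_cdivide[OF DERIV_mult[OF riccati_derivative[OF z t'] DERIV_power[OF N'[OF t]]]]])
          (use k0_pos[OF t'] p_pos[OF t'] in \<open>simp add: d_def w_def field_simps power2_eq_square\<close>)
    qed
  qed
  then have d: "(d has_integral 0) {a..b}" by (simp add: H_def \<eta>)
  have "integrand \<eta> t - d t = r t" if t: "t \<in> {a..b}" for t
  proof -
    have "integrand \<eta> t - d t = w t * (p t * (D \<eta> t)\<^sup>2 + (z t)\<^sup>2 / p t * (\<eta> t)\<^sup>2 - 2 * z t * \<eta> t * D \<eta> t)"
      by (simp add: integrand_def d_def w_def algebra_simps diff_divide_distrib add_divide_distrib)
    also have "p t * (D \<eta> t)\<^sup>2 + (z t)\<^sup>2 / p t * (\<eta> t)\<^sup>2 - 2 * z t * \<eta> t * D \<eta> t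
        = p t * (D \<eta> t - z t * \<eta> t / p t)\<^sup>2"
      using p_pos[OF t] by (simp add: field_simps power2_eq_square)
    finally show ?thesis by (simp add: r_def)
  qed
  then have r: "(r has_integral quad_functional k0 k1 p q a b \<eta>) {a..b}"
    using has_integral_diff[OF quad_functional_has_integral[OF \<eta>(1)] d]
    by (subst (asm) has_integral_cong) simp_all
  have w_pos: "0 < w t" if "t \<in> {a..b}" for t
    using k0_pos[OF that] by (simp add: w_def)
  have nonneg: "0 \<le> r t" if "t \<in> {a..b}" for t
    using w_pos[OF that] p_pos[OF that] by (simp add: r_def)
  have "0 \<le> quad_functional k0 k1 p q a b \<eta>"
    using r nonneg by (rule has_integral_nonneg)
  moreover have "quad_functional k0 k1 p q a b \<eta> \<noteq> 0"
  proof
    assume "quad_functional k0 k1 p q a b \<eta> = 0"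
    with r have r0: "(r has_integral 0) {a..b}" by simp
    have sub: "continuous_on ({a..b} - T) f" if "continuous_on {a..b} f" for f :: "real \<Rightarrow> real"
      using that continuous_on_subset by blast
    have cr: "continuous_on ({a..b} - T) r"
      unfolding r_def w_def prop_deriv_def
      by (intro continuous_intros sub[OF p_continuous] sub[OF k0_continuous] sub[OF k1_continuous]
          sub[OF E_continuous] sub[OF c\<eta>] sub[OF cz] h) (use p_pos k0_pos in force)+
    have D\<eta>: "D \<eta> t = z t * \<eta> t / p t" if t: "t \<in> {a<..<b} - T" for t
    proof -
      have "r t = 0" by (rule nonneg_has_integral_zero[OF T cr nonneg r0 t])
      then show ?thesis using w_pos[of t] p_pos[of t] t by (simp add: r_def)
    qed
    obtain X where X: "hamiltonian X (\<lambda>t. z t * X t)" "\<And>t. 0 < X t"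
      using riccati_imp_nonvanishing[OF z] by blast
    \<comment> \<open>Off finitely many points \<open>D \<eta> = z \<eta> / p\<close>, so
      \<open>E \<eta>\<close> and \<open>X\<close> obey the same first-order equation; their
      quotient has derivative zero and starts at zero.\<close>
    define W where "W = (\<lambda>t. E t * \<eta> t / X t)"
    have "W t = 0" if "t \<in> {a..b}" for t
    proof (rule has_derivative_zero_unique_strong_interval[OF _ _ _ _ that])
      show "finite (T \<union> {a, b})" using T by simp
      show "continuous_on {a..b} W"
        unfolding W_def using X(2)
        by (intro continuous_intros E_continuous c\<eta> hamiltonian_continuous[OF X(1)]) (metis less_irrefl)
      show "W a = 0" by (simp add: W_def \<eta>)
      fix s assume "s \<in> {a..b} - (T \<union> {a, b})"
      then have s: "s \<in> {a..b} - T" "s \<in> {a<..<b} - T" "s \<in> {a..b}" by auto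
      have "X s \<noteq> 0" using X(2)[of s] by simp
      have "(W has_real_derivative 0) (at s within {a..b})"
        unfolding W_def
        by (rule DERIV_cong[OF DERIV_divide[OF N'[OF s(1)] hamiltonianD(1)[OF X(1) s(3)] \<open>X s \<noteq> 0\<close>]])
          (simp add: D\<eta>[OF s(2)])
      then show "(W has_derivative (\<lambda>h. 0)) (at s within {a..b})"
        by (simp add: has_field_derivative_def lambda_zero)
    qed
    then have "\<eta> t = 0" if "t \<in> {a..b}" for t
      using that X(2)[of t] unfolding W_def by (metis E_nonzero divide_eq_0_iff less_irrefl mult_eq_0_iff)
    with nz show False by blast
  qed
  ultimately show ?thesis by simp
qed

section \<open>Cutting off a function outside two of its zeros\<close>

lemma clamp_derivative:
  fixes f :: "real \<Rightarrow> real"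
  assumes "s < t" "f s = 0" "f t = 0" and u: "u \<in> {a..b} - {s, t}"
    and f: "(f has_real_derivative d) (at u within {a..b})"
  shows "((\<lambda>u. f (max s (min t u))) has_real_derivative (if s < u \<and> u < t then d else 0))
    (at u within {a..b})"
proof -
  have u': "u \<in> {a..b}" "u \<noteq> s" "u \<noteq> t" using u by auto
  consider "u < s" | "s < u" "u < t" | "t < u" using u' by linarith
  then show ?thesis
  proof cases
    case 1
    have "((\<lambda>u. f (max s (min t u))) has_real_derivative 0) (at u within {a..b})"
      by (rule has_field_derivative_transform_within[OF DERIV_const, of "s - u" _ _ 0])
        (use 1 assms u' in \<open>auto simp: dist_real_def max_def min_def\<close>)
    then show ?thesis using 1 by simp
  next
    case 2
    have near: "y = max s (min t y)" if "dist y u < min (u - s) (t - u)" for y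
      using that by (auto simp: dist_real_def)
    have "((\<lambda>u. f (max s (min t u))) has_real_derivative d) (at u within {a..b})"
      by (rule has_field_derivative_transform_within[OF f, of "min (u - s) (t - u)"])
        (use 2 u' in \<open>auto simp flip: near\<close>)
    then show ?thesis using 2 by simp
  next
    case 3
    have "((\<lambda>u. f (max s (min t u))) has_real_derivative 0) (at u within {a..b})"
      by (rule has_field_derivative_transform_within[OF DERIV_const, of "u - t" _ _ 0])
        (use 3 assms u' in \<open>auto simp: dist_real_def max_def min_def\<close>)
    then show ?thesis using 3 by simp
  qed
qed

text \<open>A one-sided limit sees only the interior of the interval, where \<open>h\<close> equals
  a function continuous up to the endpoints; at the junctions \<open>h\<close> may take any
  value.\<close>

lemma one_sided_limits_of_continuous_piece:
  fixes g h :: "real \<Rightarrow> real"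
  assumes g: "continuous_on {a..b} g" and "a \<le> c" "c < e" "e \<le> b"
    and gh: "\<And>u. u \<in> {c<..<e} \<Longrightarrow> h u = g u"
  shows "\<exists>l. (h \<longlongrightarrow> l) (at_right c)" "\<exists>l. (h \<longlongrightarrow> l) (at_left e)"
proof -
  have "continuous_on {c..e} g" by (rule continuous_on_subset[OF g]) (use assms in auto)
  then have lim: "(g \<longlongrightarrow> g c) (at_right c)" "(g \<longlongrightarrow> g e) (at_left e)"
    using \<open>c < e\<close> by (blast intro: continuous_on_Icc_at_rightD continuous_on_Icc_at_leftD)+
  have "\<forall>\<^sub>F u in at_right c. g u = h u"
    by (rule eventually_at_rightI[OF _ \<open>c < e\<close>]) (simp add: gh)
  with lim(1) show "\<exists>l. (h \<longlongrightarrow> l) (at_right c)" by (blast intro: Lim_transform_eventually)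
  have "\<forall>\<^sub>F u in at_left e. g u = h u"
    by (rule eventually_at_leftI[OF _ \<open>c < e\<close>]) (simp add: gh)
  with lim(2) show "\<exists>l. (h \<longlongrightarrow> l) (at_left e)" by (blast intro: Lim_transform_eventually)
qed

text \<open>Clamping the argument to \<open>{s..t}\<close> extends \<open>f\<close> by its zero end
  values, so continuity is that of a composition. The derivative is \<open>f'\<close> inside and
  zero outside, with \<open>s\<close> and \<open>t\<close> as exceptional points.\<close>

lemma clamp_piecewise_C1:
  fixes f :: "real \<Rightarrow> real"
  assumes st: "a \<le> s" "s < t" "t \<le> b" and zero: "f s = 0" "f t = 0"
    and f: "\<And>u. u \<in> {a..b} \<Longrightarrow> (f has_real_derivative f' u) (at u within {a..b})"
    and f': "continuous_on {a..b} f'"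
  shows "piecewise_C1 a b (\<lambda>u. f (max s (min t u)))"
proof -
  define \<eta> where "\<eta> = (\<lambda>u. f (max s (min t u)))"
  define h where "h = (\<lambda>u. vector_derivative \<eta> (at u within {a..b}))"
  have \<eta>': "(\<eta> has_real_derivative (if s < u \<and> u < t then f' u else 0)) (at u within {a..b})"
    if "u \<in> {a..b} - {s, t}" for u
    unfolding \<eta>_def using that by (intro clamp_derivative st zero f) auto
  have h: "h u = (if s < u \<and> u < t then f' u else 0)" if "u \<in> {a..b} - {s, t}" for u
    unfolding h_def using that \<eta>'[OF that]
    by (intro vector_derivative_within_closed_interval[OF a_less_b])
      (auto simp: has_real_derivative_iff_has_vector_derivative)
  have cont: "continuous_on {a..b} \<eta>"
    unfolding \<eta>_def using st
    by (intro continuous_on_compose2[OF DERIV_continuous_on[OF f]] continuous_intros) auto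
  have right: "\<exists>l. (h \<longlongrightarrow> l) (at_right c)" if c: "c \<in> {a..<b}" for c
  proof -
    consider "c < s" | "s \<le> c" "c < t" | "t \<le> c" by linarith
    then show ?thesis
    proof cases
      case 1
      show ?thesis
        by (rule one_sided_limits_of_continuous_piece(1)[of "\<lambda>_. 0" c s])
          (use 1 c st in \<open>auto simp: h\<close>)
    next
      case 2
      show ?thesis
        by (rule one_sided_limits_of_continuous_piece(1)[OF f', of c t])
          (use 2 c st in \<open>auto simp: h\<close>)
    next
      case 3
      show ?thesis
        by (rule one_sided_limits_of_continuous_piece(1)[of "\<lambda>_. 0" c b])
          (use 3 c st in \<open>auto simp: h\<close>)
    qed
  qed
  have left: "\<exists>l. (h \<longlongrightarrow> l) (at_left c)" if c: "c \<in> {a<..b}" for c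
  proof -
    consider "c \<le> s" | "s < c" "c \<le> t" | "t < c" by linarith
    then show ?thesis
    proof cases
      case 1
      show ?thesis
        by (rule one_sided_limits_of_continuous_piece(2)[of "\<lambda>_. 0" a c])
          (use 1 c st in \<open>auto simp: h\<close>)
    next
      case 2
      show ?thesis
        by (rule one_sided_limits_of_continuous_piece(2)[OF f', of s c])
          (use 2 c st in \<open>auto simp: h\<close>)
    next
      case 3
      show ?thesis
        by (rule one_sided_limits_of_continuous_piece(2)[of "\<lambda>_. 0" t c])
          (use 3 c st in \<open>auto simp: h\<close>)
    qed
  qed
  have "continuous_on ({a..b} - {s, t}) h"
    unfolding continuous_on_eq_continuous_within
  proof
    fix u assume u: "u \<in> {a..b} - {s, t}"
    define d where "d = min \<bar>u - s\<bar> \<bar>u - t\<bar>"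
    have d: "0 < d" using u by (auto simp: d_def)
    show "continuous (at u within {a..b} - {s, t}) h"
    proof (cases "s < u \<and> u < t")
      case True
      have "continuous (at u within {a..b} - {s, t}) f'"
        using f' u continuous_on_subset[OF f', of "{a..b} - {s, t}"]
        by (auto simp: continuous_on_eq_continuous_within)
      then show ?thesis
      proof (rule continuous_transform_within[OF _ d u])
        fix y assume y: "y \<in> {a..b} - {s, t}" "dist y u < d"
        then have "s < y \<and> y < t" using True by (auto simp: d_def dist_real_def)
        then show "f' y = h y" using h[OF y(1)] by simp
      qed
    next
      case False
      show ?thesis
      proof (rule continuous_transform_within[OF continuous_const[of _ 0] d u])
        fix y assume y: "y \<in> {a..b} - {s, t}" "dist y u < d"
        then have "\<not> (s < y \<and> y < t)" using False u by (auto simp: d_def dist_real_def)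
        then show "0 = h y" using h[OF y(1)] by auto
      qed
    qed
  qed
  moreover have "\<eta> differentiable (at u within {a..b})" if "u \<in> {a..b} - {s, t}" for u
    using \<eta>'[OF that] by (auto simp: real_differentiable_def)
  ultimately have "\<exists>T. finite T \<and> (\<forall>u\<in>{a..b} - T. \<eta> differentiable (at u within {a..b})) \<and>
      continuous_on ({a..b} - T) h"
    by (intro exI[of _ "{s, t}"]) simp
  then have "piecewise_C1 a b \<eta>"
    using cont left right unfolding piecewise_C1_def h_def by blast
  then show ?thesis unfolding \<eta>_def .
qed

text \<open>A solution with two zeros, cut off outside them, is admissible and makes the functional vanish:
  after cutting off, \<open>X Y\<close> is an antiderivative of the integrand.\<close>

lemma positive_definite_imp_disconjugate:
  assumes pos: "\<And>\<eta>. \<eta> \<in> admissible a b \<Longrightarrow> 0 < quad_functional k0 k1 p q a b \<eta>"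
    and x: "sl_solution k0 k1 p q a b x" and st: "a \<le> s" "s < t" "t \<le> b"
    and zero: "x s = 0" "x t = 0" and u: "u \<in> {a..b}"
  shows "x u = 0"
proof -
  define X where "X = (\<lambda>t. E t * x t)"
  define Y where "Y = (\<lambda>t. E t * (p t * D x t))"
  have XY: "hamiltonian X Y"
    unfolding X_def Y_def by (rule sl_solution_imp_hamiltonian[OF x])
  have sub: "c \<in> {a..b}" if "c \<in> {s..t}" for c using that st by auto
  define x' where "x' = (\<lambda>u. (D x u - k1 u * x u) / k0 u)"
  have x': "(x has_real_derivative x' u) (at u within {a..b})" if "u \<in> {a..b}" for u
    unfolding x'_def using x that
    by (intro prop_deriv_has_derivative) (auto simp: sl_solution_def differentiable_on_def)
  have cx': "continuous_on {a..b} x'"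
    unfolding x'_def using x
    by (intro continuous_intros k0_continuous k1_continuous)
      (auto simp: sl_solution_def dest: k0_pos)
  define \<eta> where "\<eta> = (\<lambda>u. x (max s (min t u)))"
  \<comment> \<open>Division by the square of \<open>E b\<close> matches the normalization of the
    weight; clamping makes \<open>H\<close> zero at both ends, because \<open>X\<close> vanishes at
    \<open>s\<close> and \<open>t\<close>.\<close>
  define H where "H = (\<lambda>u. X (max s (min t u)) * Y (max s (min t u)) / (E b)\<^sup>2)"
  have \<eta>: "piecewise_C1 a b \<eta>"
    unfolding \<eta>_def by (rule clamp_piecewise_C1[OF st zero x' cx'])
  have \<eta>': "(\<eta> has_real_derivative (if s < u \<and> u < t then x' u else 0)) (at u within {a..b})"
    if "u \<in> {a..b} - {s, t}" for u
    unfolding \<eta>_def using that by (intro clamp_derivative st zero x') auto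
  have "(integrand \<eta> has_integral (H b - H a)) {a..b}"
  proof (rule has_integral_derivative_off_finite[of "{s, t}"])
    show "continuous_on {a..b} H"
      unfolding H_def using st
      by (intro continuous_intros continuous_on_compose2[OF hamiltonian_continuous(1)[OF XY]]
          continuous_on_compose2[OF hamiltonian_continuous(2)[OF XY]]) auto
    fix u assume u: "u \<in> {a..b} - {s, t}"
    then have u': "u \<in> {a..b}" by blast
    define d where "d = (p u * (D x u)\<^sup>2 - q u * (x u)\<^sup>2) * (E u / E b)\<^sup>2 / k0 u"
    have "((\<lambda>u. X u * Y u / (E b)\<^sup>2) has_real_derivative d) (at u within {a..b})"
      by (rule DERIV_cong[OF DERIV_cdivide[OF DERIV_mult[OF hamiltonianD[OF XY u']]]])
        (use p_pos[OF u'] k0_pos[OF u'] in \<open>simp add: d_def X_def Y_def field_simps power2_eq_square\<close>)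
    then have "(H has_real_derivative (if s < u \<and> u < t then d else 0)) (at u within {a..b})"
      unfolding H_def using st zero u by (intro clamp_derivative) (auto simp: X_def)
    moreover have "(if s < u \<and> u < t then d else 0) = integrand \<eta> u"
    proof (cases "s < u \<and> u < t")
      case True
      then have "\<eta> u = x u" "D \<eta> u = D x u"
        using prop_deriv_eq[OF u' \<eta>'[OF u]] prop_deriv_eq[OF u' x'[OF u']] by (auto simp: \<eta>_def)
      with True show ?thesis by (simp add: integrand_def d_def)
    next
      case False
      then have "\<eta> u = 0" using u zero st by (auto simp: \<eta>_def max_def min_def)
      moreover have "D \<eta> u = 0" using prop_deriv_eq[OF u' \<eta>'[OF u]] False \<open>\<eta> u = 0\<close> by auto
      ultimately show ?thesis by (subst if_not_P[OF False]) (simp add: integrand_def)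
    qed
    ultimately show "(H has_real_derivative integrand \<eta> u) (at u within {a..b})" by simp
  qed simp
  moreover have "H b = 0" "H a = 0" using st zero by (auto simp: H_def X_def max_def min_def)
  ultimately have "quad_functional k0 k1 p q a b \<eta> = 0"
    using has_integral_unique[OF quad_functional_has_integral[OF \<eta>]] by auto
  \<comment> \<open>Positivity excludes \<eta> from the admissible functions, yet it meets every
    condition except possibly being nonzero; hence it vanishes.\<close>
  with pos[of \<eta>] have "\<eta> \<notin> admissible a b" by auto
  moreover have "\<eta> a = 0" "\<eta> b = 0" using st zero by (auto simp: \<eta>_def max_def min_def)
  ultimately have \<eta>0: "\<eta> c = 0" if "c \<in> {a..b}" for c
    using \<eta> that unfolding admissible_def by blast
  have X0: "X c = 0" if "c \<in> {s..t}" for c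
    using \<eta>0[OF sub[OF that]] that by (simp add: \<eta>_def X_def)
  \<comment> \<open>With \<open>X\<close> zero on the whole subinterval, \<open>Y\<close> vanishes
    at \<open>s\<close> too, and uniqueness with zero data there spreads the zero to all of
    \<open>{a..b}\<close>.\<close>
  have "Y s = 0"
    by (rule hamiltonian_vanish_interval[OF XY st(2) _ X0]) (use st in auto)
  then have "X u = 0"
    using hamiltonian_vanish[OF XY _ _ _ u, of s] X0[of s] st by auto
  then show ?thesis by (simp add: X_def)
qed

subsection \<open>The equivalences\<close>

text \<open>An admissible function is nonzero somewhere, so the second clause of positive
  definiteness amounts to the functional being nonzero.\<close>

lemma positive_definite_iff:
  "positive_definite_on_admissible k0 k1 p q a b \<longleftrightarrow>
     (\<forall>\<eta>\<in>admissible a b. 0 < quad_functional k0 k1 p q a b \<eta>)"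
  unfolding positive_definite_on_admissible_def admissible_def by (force simp: less_le)

text \<open>A second zero would make the solution trivial, and then \<open>p D x\<close> vanishes as
  well, against the prescribed slope.\<close>

lemma disconjugate_imp_ivp_nonzero:
  assumes dis: "disconjugate k0 k1 p q a b" and t0: "t0 \<in> {a..b}"
    and x: "sl_ivp_solution k0 k1 p q a b t0 0 (1 / p t0) x"
    and t: "t \<in> {a..b}" "t \<noteq> t0"
  shows "x t \<noteq> 0"
proof
  assume "x t = 0"
  have sol: "sl_solution k0 k1 p q a b x" "x t0 = 0" "D x t0 = 1 / p t0"
    using x by (simp_all add: sl_ivp_solution_def)
  with dis t t0 \<open>x t = 0\<close> have "x s = 0" if "s \<in> {a..b}" for s
    using that unfolding disconjugate_def by metis
  then have "E t0 * (p t0 * D x t0) = 0"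
    by (intro hamiltonian_vanish_interval[OF sl_solution_imp_hamiltonian[OF sol(1)] a_less_b subset_refl _ t0])
      simp
  then show False using sol(3) p_pos[OF t0] by simp
qed

lemma ivp_imp_hamiltonian:
  assumes x: "sl_ivp_solution k0 k1 p q a b t0 0 (1 / p t0) x" and t0: "t0 \<in> {a..b}"
  obtains X Y where "hamiltonian X Y" "X t0 = 0" "Y t0 \<noteq> 0" "\<And>t. X t = E t * x t"
proof (rule that)
  show "hamiltonian (\<lambda>t. E t * x t) (\<lambda>t. E t * (p t * D x t))"
    using x by (intro sl_solution_imp_hamiltonian) (simp add: sl_ivp_solution_def)
  show "E t0 * x t0 = 0" "E t0 * (p t0 * D x t0) \<noteq> 0"
    using x p_pos[OF t0] by (simp_all add: sl_ivp_solution_def)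
qed simp

text \<open>The datum \<open>E t0\<close> makes \<open>p D x = Y / E\<close> equal to one at
  \<open>t0\<close>, which is the normalized initial slope.\<close>

lemma hamiltonian_imp_ivp:
  assumes "hamiltonian X Y" "X t0 = 0" "Y t0 = E t0" and t0: "t0 \<in> {a..b}"
  shows "sl_ivp_solution k0 k1 p q a b t0 0 (1 / p t0) (\<lambda>t. X t / E t)"
  using hamiltonian_imp_sl_solution(1)[OF assms(1)] hamiltonian_imp_sl_solution(2)[OF assms(1) t0]
    assms p_pos[OF t0]
  by (simp add: sl_ivp_solution_def eq_divide_eq mult.commute)

text \<open>The implications run from (i) through (ii) and (iii) to (iv), from (iv) to both (v) and
  (vi), and from each of these back to (i). Existence is part of the last two entries, so that the
  way back has a solution to start from; they range over all solutions because a total function is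
  determined only on \<open>{a..b}\<close>.\<close>

lemma reid_roundabout:
  "all_equivalent
    [\<exists>x. sl_solution k0 k1 p q a b x \<and> (\<forall>t\<in>{a..b}. x t \<noteq> 0),
     \<exists>z. riccati_solution k0 k1 p q a b z,
     positive_definite_on_admissible k0 k1 p q a b,
     disconjugate k0 k1 p q a b,
     (\<exists>u. sl_ivp_solution k0 k1 p q a b a 0 (1 / p a) u) \<and>
       (\<forall>u. sl_ivp_solution k0 k1 p q a b a 0 (1 / p a) u \<longrightarrow> (\<forall>t\<in>{a<..b}. u t \<noteq> 0)),
     (\<exists>v. sl_ivp_solution k0 k1 p q a b b 0 (1 / p b) v) \<and>
       (\<forall>v. sl_ivp_solution k0 k1 p q a b b 0 (1 / p b) v \<longrightarrow> (\<forall>t\<in>{a..<b}. v t \<noteq> 0))]"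
  (is "all_equivalent [?i, ?ii, ?iii, ?iv, ?v, ?vi]")
proof -
  have ab: "a \<in> {a..b}" "b \<in> {a..b}" using a_less_b by auto
  have nonvanishing: ?i if "hamiltonian X Y" "\<And>t. t \<in> {a..b} \<Longrightarrow> X t \<noteq> 0" for X Y
    using hamiltonian_imp_sl_solution(1)[OF that(1)] that(2)
    by (intro exI[of _ "\<lambda>t. X t / E t"]) simp
  have 1: ?ii if ?i
  proof -
    from that obtain x where x: "sl_solution k0 k1 p q a b x" "\<forall>t\<in>{a..b}. x t \<noteq> 0" by blast
    show ?ii
      using nonvanishing_imp_riccati[OF sl_solution_imp_hamiltonian[OF x(1)]] x(2) by auto
  qed
  have 2: ?iii if ?ii
    using that riccati_imp_quad_functional_pos positive_definite_iff by blast
  have 3: ?iv if ?iii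
  proof -
    have pos: "0 < quad_functional k0 k1 p q a b \<eta>" if "\<eta> \<in> admissible a b" for \<eta>
      using \<open>?iii\<close> that by (simp add: positive_definite_iff)
    have "x u = 0" if x: "sl_solution k0 k1 p q a b x" and "u \<in> {a..b}"
      "s \<in> {a..b}" "t \<in> {a..b}" "s \<noteq> t" "x s = 0" "x t = 0" for x s t u
      using that positive_definite_imp_disconjugate[OF pos x, of s t u]
        positive_definite_imp_disconjugate[OF pos x, of t s u]
      by (cases s t rule: linorder_cases) auto
    then show ?iv unfolding disconjugate_def by blast
  qed
  have 4: ?v if ?iv
  proof
    obtain X Y where "hamiltonian X Y" "X a = 0" "Y a = E a"
      by (rule hamiltonian_exists_left)
    then show "\<exists>u. sl_ivp_solution k0 k1 p q a b a 0 (1 / p a) u"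
      using hamiltonian_imp_ivp ab by blast
  qed (use disconjugate_imp_ivp_nonzero[OF that ab(1)] in auto)
  have 5: ?vi if ?iv
  proof
    obtain X Y where "hamiltonian X Y" "X b = 0" "Y b = E b"
      by (rule hamiltonian_exists_right)
    then show "\<exists>u. sl_ivp_solution k0 k1 p q a b b 0 (1 / p b) u"
      using hamiltonian_imp_ivp ab by blast
  qed (use disconjugate_imp_ivp_nonzero[OF that ab(2)] in auto)
  have 6: ?i if ?v
  proof -
    from that obtain u where u: "sl_ivp_solution k0 k1 p q a b a 0 (1 / p a) u"
      "\<forall>t\<in>{a<..b}. u t \<noteq> 0" by blast
    obtain U Y where U: "hamiltonian U Y" "U a = 0" "Y a \<noteq> 0" "\<And>t. U t = E t * u t"
      using ivp_imp_hamiltonian[OF u(1) ab(1)] by blast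
    obtain X X' where "hamiltonian X X'" "\<And>t. t \<in> {a..b} \<Longrightarrow> X t \<noteq> 0"
      by (rule nonvanishing_from_left[OF U(1-3)]) (use u(2) U(4) in auto)
    then show ?i by (rule nonvanishing)
  qed
  have 7: ?i if ?vi
  proof -
    from that obtain v where v: "sl_ivp_solution k0 k1 p q a b b 0 (1 / p b) v"
      "\<forall>t\<in>{a..<b}. v t \<noteq> 0" by blast
    obtain V Z where V: "hamiltonian V Z" "V b = 0" "Z b \<noteq> 0" "\<And>t. V t = E t * v t"
      using ivp_imp_hamiltonian[OF v(1) ab(2)] by blast
    obtain X X' where "hamiltonian X X'" "\<And>t. t \<in> {a..b} \<Longrightarrow> X t \<noteq> 0"
      by (rule nonvanishing_from_right[OF V(1-3)]) (use v(2) V(4) in auto)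
    then show ?i by (rule nonvanishing)
  qed
  from 1 2 3 4 5 6 7 have "?i = ?ii" "?ii = ?iii" "?iii = ?iv" "?iv = ?v" "?v = ?vi" by argo+
  then show ?thesis unfolding all_equivalent_def by simp
qed

end

theorem theorem8p1:
  fixes I :: "real set"
    and \<kappa>0 \<kappa>1 :: "real \<Rightarrow> real \<Rightarrow> real"
    and \<alpha> a b :: real
    and p q :: "real \<Rightarrow> real"
  assumes "is_interval I"
    and "\<exists>s\<in>I. \<exists>t\<in>I. s < t"
    and "proportional_kernels I \<kappa>0 \<kappa>1"
    and "0 < \<alpha>" and "\<alpha> \<le> 1"
    and "a < b" and "{a..b} \<subseteq> I"
    and "continuous_on {a..b} p" and "\<forall>t\<in>{a..b}. 0 < p t"
    and "continuous_on {a..b} q"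
  shows "all_equivalent
    [\<exists>x. sl_solution (\<kappa>0 \<alpha>) (\<kappa>1 \<alpha>) p q a b x \<and> (\<forall>t\<in>{a..b}. x t \<noteq> 0),
     \<exists>z. riccati_solution (\<kappa>0 \<alpha>) (\<kappa>1 \<alpha>) p q a b z,
     positive_definite_on_admissible (\<kappa>0 \<alpha>) (\<kappa>1 \<alpha>) p q a b,
     disconjugate (\<kappa>0 \<alpha>) (\<kappa>1 \<alpha>) p q a b,
     (\<exists>u. sl_ivp_solution (\<kappa>0 \<alpha>) (\<kappa>1 \<alpha>) p q a b a 0 (1 / p a) u) \<and>
       (\<forall>u. sl_ivp_solution (\<kappa>0 \<alpha>) (\<kappa>1 \<alpha>) p q a b a 0 (1 / p a) u \<longrightarrow>
          (\<forall>t\<in>{a<..b}. u t \<noteq> 0)),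
     (\<exists>v. sl_ivp_solution (\<kappa>0 \<alpha>) (\<kappa>1 \<alpha>) p q a b b 0 (1 / p b) v) \<and>
       (\<forall>v. sl_ivp_solution (\<kappa>0 \<alpha>) (\<kappa>1 \<alpha>) p q a b b 0 (1 / p b) v \<longrightarrow>
          (\<forall>t\<in>{a..<b}. v t \<noteq> 0))]"
proof -
  have slice: "continuous_on {a..b} (f \<alpha>)"
    if "continuous_on ({0..1} \<times> I) (\<lambda>(\<alpha>, t). f \<alpha> t)" for f :: "real \<Rightarrow> real \<Rightarrow> real"
  proof -
    have "continuous_on {a..b} (\<lambda>t. (\<lambda>(\<alpha>, t). f \<alpha> t) (\<alpha>, t))"
      by (rule continuous_on_compose2[OF that]) (use assms in \<open>auto intro!: continuous_intros\<close>)
    then show ?thesis by simp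
  qed
  \<comment> \<open>For \<alpha> in \<open>{0<..1}\<close> the kernel is nonnegative and nonzero,
    hence positive, which permits the divisions by \<open>k0\<close> in the locale.\<close>
  have "0 < \<kappa>0 \<alpha> t" if "t \<in> {a..b}" for t
  proof -
    have "t \<in> I" "\<alpha> \<in> {0..1}" "\<alpha> \<in> {0<..1}" using that assms by auto
    then have "0 \<le> \<kappa>0 \<alpha> t" "\<kappa>0 \<alpha> t \<noteq> 0"
      using assms(3) unfolding proportional_kernels_def by blast+
    then show ?thesis by simp
  qed
  then interpret proportional_sl "\<kappa>0 \<alpha>" "\<kappa>1 \<alpha>" p q a b
    using assms slice by unfold_locales (auto simp: proportional_kernels_def)
  show ?thesis by (rule reid_roundabout)
qed

end
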